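(* Let $K$ be a Killing tensor on the torus $T^n$ equipped with a metric of the form $\tilde g = e^{2f(x_n)}(\mathrm{d}x_1^2+\cdots+\mathrm{d}x_n^2)$. Then $K$ is a polynomial in the Killing vector fields $\frac{\partial}{\partial x_1},\ldots,\frac{\partial}{\partial x_{n-1}}$ and in the metric tensor $\tilde g$.
   Context: Here $T^n$ is the $n$-dimensional torus with standard coordinates $x_1,\ldots,x_n$, and $f$ is a smooth real-valued function on $T^n$ depending only on the last variable $x_n$. For a Riemannian manifold $(M,\tilde g)$, $\mathrm{Sym}^p\,\mathrm{T}M\subset \mathrm{T}M^{\otimes p}$ denotes the $p$-fold symmetric tensor power of the tangent bundle, with symmetric product $v_1\cdot\ldots\cdot v_p=\sum_{\sigma\in S_p}v_{\sigma(1)}\otimes\cdots\otimes v_{\sigma(p)}$. Polynomials are taken with respect to this symmetric product, with constant real coefficients. Tangent and cotangent bundles are identified by means of the metric; under this identification the metric tensor is viewed as a symmetric $2$-tensor: $2\tilde g=\sum_i \tilde e_i\cdot\tilde e_i\in\Gamma(\mathrm{Sym}^2\,\mathrm{T}M)$ for any local $\tilde g$-orthonormal frame $\{\tilde e_i\}$. For $\tilde g = e^{2f}(\mathrm{d}x_1^2+\cdots+\mathrm{d}x_n^2)$ this is $e^{-2f}\sum_{j=1}^n \frac{\partial}{\partial x_j}\cdot\frac{\partial}{\partial x_j}$. A section $K\in\Gamma(\mathrm{Sym}^p\,\mathrm{T}M)$ is a Killing tensor of $(M,\tilde g)$ if $\sum_i \tilde e_i\cdot\tilde\nabla_{\tilde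 e_i}K=0$ for local $\tilde g$-orthonormal frames $\{\tilde e_i\}$, where $\tilde\nabla$ is the Levi-Civita connection of $\tilde g$; equivalently, the symmetrized covariant derivative of $K$ vanishes; equivalently, $(\tilde\nabla_XK)(X,\ldots,X)=0$ for all vector fields $X$. For $p=1$ these are the Killing vector fields.
   Formalization: The formal theorem assumes n ≥ 2 and f non-constant; otherwise the claim fails: for constant f the field ∂/∂x_n is Killing but not such a polynomial, and for n = 1 the unit field e^{-f}∂/∂x_1 is Killing of odd degree. *)

theory Defs
  imports "HOL-Analysis.Analysis" "HOL-Combinatorics.Permutations"
begin

text \<open>
  The torus is the quotient of \<open>real^'n\<close> by the integer lattice, and its tangent bundle is trivialised
  by the coordinate fields. Functions on the torus are functions on \<open>real^'n\<close> that are periodic in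
  every coordinate; tensor fields are given by their components in the coordinate frame.
\<close>

definition partial_deriv :: "'n \<Rightarrow> (real^'n \<Rightarrow> real) \<Rightarrow> real^'n \<Rightarrow> real" where
  "partial_deriv i u x = frechet_derivative u (at x) (axis i 1)"

text \<open>All iterated partial derivatives exist and are (totally) differentiable everywhere.\<close>

definition smooth :: "(real^'n \<Rightarrow> real) \<Rightarrow> bool" where
  "smooth u \<longleftrightarrow> (\<forall>is x. foldr partial_deriv is u differentiable (at x))"

definition periodic :: "(real^'n \<Rightarrow> real) \<Rightarrow> bool" where
  "periodic u \<longleftrightarrow> (\<forall>x i. u (x + axis i 1) = u x)"

definition smooth_on_torus :: "(real^'n \<Rightarrow> real) \<Rightarrow> bool" where
  "smooth_on_torus u \<longleftrightarrow> smooth u \<and> periodic u"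


text \<open>
  A contravariant tensor assigns to \<open>[i\<^sub>1, \<dots>, i\<^sub>p]\<close> its component with upper indices \<open>i\<^sub>1, \<dots>, i\<^sub>p\<close>.
  Lists of all lengths are allowed, so that this is the whole tensor algebra and the degree is not part
  of the type; a tensor of degree \<open>p\<close> vanishes on lists of any other length.
\<close>

type_synonym 'n tensor = "'n list \<Rightarrow> real"
type_synonym 'n tensor_field = "real^'n \<Rightarrow> 'n tensor"

definition sym_tensor :: "nat \<Rightarrow> 'n tensor \<Rightarrow> bool" where
  "sym_tensor p A \<longleftrightarrow>
     (\<forall>is. length is \<noteq> p \<longrightarrow> A is = 0) \<and>
     (\<forall>is \<sigma>. \<sigma> permutes {..<length is} \<longrightarrow> A (permute_list \<sigma> is) = A is)"

definition sym_tensor_field :: "nat \<Rightarrow> 'n::finite tensor_field \<Rightarrow> bool" where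
  "sym_tensor_field p K \<longleftrightarrow>
     (\<forall>x. sym_tensor p (K x)) \<and> (\<forall>is. smooth_on_torus (\<lambda>x. K x is))"

definition scalar_tensor :: "real \<Rightarrow> 'n tensor" where
  "scalar_tensor c is = (case is of [] \<Rightarrow> c | _ \<Rightarrow> 0)"

definition vec_tensor :: "real^'n \<Rightarrow> 'n tensor" where
  "vec_tensor v is = (case is of [i] \<Rightarrow> v $ i | _ \<Rightarrow> 0)"

text \<open>
  The symmetric product with the normalisation
  \<open>v\<^sub>1 \<cdot> \<dots> \<cdot> v\<^sub>p = (\<Sum>\<sigma>. v\<^bsub>\<sigma>(1)\<^esub> \<otimes> \<dots> \<otimes> v\<^bsub>\<sigma>(p)\<^esub>)\<close>, so that \<open>v \<cdot> w = v \<otimes> w + w \<otimes> v\<close>. The compatible product of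
  symmetric tensors \<open>A\<close> of degree \<open>k\<close> and \<open>B\<close> of degree \<open>m\<close> is \<open>1 / (k! m!)\<close> times the sum of all
  permutations of \<open>A \<otimes> B\<close>; the sum over \<open>k\<close> runs through the homogeneous parts of \<open>A\<close>.
\<close>

definition sym_prod :: "'n tensor \<Rightarrow> 'n tensor \<Rightarrow> 'n tensor" where
  "sym_prod A B is =
     (\<Sum>k\<le>length is. (\<Sum>\<sigma> | \<sigma> permutes {..<length is}.
         A (take k (permute_list \<sigma> is)) * B (drop k (permute_list \<sigma> is)))
       / (fact k * fact (length is - k)))"

text \<open>
  Values of polynomials, with constant real coefficients and with respect to the symmetric product,
  in the tensor fields belonging to \<open>G\<close>.
\<close>

inductive_set polynomials_in :: "'n tensor_field set \<Rightarrow> 'n tensor_field set"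
  for G :: "'n tensor_field set" where
  const: "(\<lambda>x. scalar_tensor c) \<in> polynomials_in G"
| gen: "A \<in> G \<Longrightarrow> A \<in> polynomials_in G"
| add: "A \<in> polynomials_in G \<Longrightarrow> B \<in> polynomials_in G \<Longrightarrow>
    (\<lambda>x is. A x is + B x is) \<in> polynomials_in G"
| mult: "A \<in> polynomials_in G \<Longrightarrow> B \<in> polynomials_in G \<Longrightarrow>
    (\<lambda>x. sym_prod (A x) (B x)) \<in> polynomials_in G"


text \<open>A Riemannian metric is given by its matrix in the coordinate frame.\<close>

type_synonym 'n metric = "real^'n \<Rightarrow> real^'n^'n"

definition orthonormal_basis_at :: "'n::finite metric \<Rightarrow> real^'n \<Rightarrow> ('n \<Rightarrow> real^'n) \<Rightarrow> bool" where
  "orthonormal_basis_at g x e \<longleftrightarrow>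
     (\<forall>i j. e i \<bullet> (g x *v e j) = (if i = j then 1 else 0))"

text \<open>\<open>christoffel g x k i j\<close> is the Christoffel symbol with upper index \<open>k\<close> and lower indices \<open>i j\<close>.\<close>

definition christoffel :: "'n::finite metric \<Rightarrow> real^'n \<Rightarrow> 'n \<Rightarrow> 'n \<Rightarrow> 'n \<Rightarrow> real" where
  "christoffel g x k i j = (\<Sum>m\<in>UNIV. matrix_inv (g x) $ k $ m *
     (partial_deriv i (\<lambda>y. g y $ j $ m) x + partial_deriv j (\<lambda>y. g y $ i $ m) x
       - partial_deriv m (\<lambda>y. g y $ i $ j) x)) / 2"

text \<open>The Levi-Civita derivative, at \<open>x\<close>, of a contravariant tensor field in the direction \<open>v\<close>.\<close>

definition cov_deriv :: "'n::finite metric \<Rightarrow> real^'n \<Rightarrow> 'n tensor_field \<Rightarrow> real^'n \<Rightarrow> 'n tensor" where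
  "cov_deriv g v K x is = (\<Sum>j\<in>UNIV. v $ j *
     (partial_deriv j (\<lambda>y. K y is) x +
      (\<Sum>r<length is. \<Sum>m\<in>UNIV. christoffel g x (is ! r) j m * K x (is[r := m]))))"

text \<open>
  The sum over \<open>i\<close> at \<open>x\<close> depends only on the values at \<open>x\<close> of a local orthonormal frame, and every
  orthonormal basis at \<open>x\<close> extends to such a frame; so the frames enter through their values.
\<close>

definition killing_tensor :: "'n::finite metric \<Rightarrow> nat \<Rightarrow> 'n tensor_field \<Rightarrow> bool" where
  "killing_tensor g p K \<longleftrightarrow> sym_tensor_field p K \<and>
     (\<forall>x e. orthonormal_basis_at g x e \<longrightarrow>
        (\<forall>is. (\<Sum>i\<in>UNIV. sym_prod (vec_tensor (e i)) (cov_deriv g (e i) K x) is) = 0))"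

text \<open>
  The metric as a contravariant tensor, both indices raised by the metric itself: this is
  \<open>\<Sum>i. e\<^sub>i \<otimes> e\<^sub>i = 1/2 (\<Sum>i. e\<^sub>i \<cdot> e\<^sub>i)\<close> for an orthonormal frame \<open>e\<close>.
\<close>

definition metric_tensor :: "'n::finite metric \<Rightarrow> 'n tensor_field" where
  "metric_tensor g x is = (case is of [i, j] \<Rightarrow> matrix_inv (g x) $ i $ j | _ \<Rightarrow> 0)"

definition coord_field :: "'n \<Rightarrow> 'n::finite tensor_field" where
  "coord_field i x = vec_tensor (axis i 1)"

definition conformal_metric :: "(real^'n \<Rightarrow> real) \<Rightarrow> 'n::finite metric" where
  "conformal_metric f x = mat (exp (2 * f x))"

end

theory Submission
  imports Defs "HOL-Complex_Analysis.Cauchy_Integral_Formula"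
begin

text \<open>
  A symmetric tensor field is a function on the cotangent bundle that is polynomial in the momenta \<open>\<xi>\<close>,
  and it is Killing iff this function \<open>P x \<xi>\<close> is a first integral of the geodesic flow. The momenta
  \<open>\<eta> = (\<xi> $ i)\<close>, \<open>i \<noteq> l\<close>, are conserved as well, and so is the energy, so \<open>P\<close> can be studied on the complex level
  sets of these integrals. At energy \<open>- e < 0\<close> the momentum \<open>\<xi> $ l = \<i> * sqrt w\<close>, \<open>w = \<bar>\<eta>\<bar>\<^sup>2 + e * exp (2 * f)\<close>,
  is imaginary, and after reparametrising \<open>x $ l\<close> the conservation law says that \<open>P\<close> is an entire
  function on each plane spanned by \<open>\<eta>\<close> and \<open>axis l 1\<close>. It is bounded by periodicity, hence constant by
  Liouville's theorem; varying \<open>\<eta>\<close> among directions that join \<open>x\<close> to lattice translates of \<open>y\<close>, and using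
  continuity in \<open>\<eta>\<close>, it does not depend on \<open>x\<close> at all.

  Split \<open>P = A + \<xi> $ l * B\<close> into parts even and odd in \<open>\<xi> $ l\<close>. Then \<open>w * B\<^sup>2\<close> is a polynomial in \<open>e\<close> that is
  independent of \<open>x\<close> and vanishes at \<open>e = - \<bar>\<eta>\<bar>\<^sup>2 / exp (2 * f x)\<close> for every \<open>x\<close>. Since \<open>f\<close> is not constant these
  are infinitely many zeros, so \<open>B = 0\<close>. What remains is \<open>A\<close>, which is independent of \<open>x\<close> when written in
  terms of \<open>\<eta>\<close> and the energy, that is, a polynomial with constant coefficients in the coordinate fields
  and the metric.
\<close>

subsection \<open>Symmetric tensors as polynomials\<close>

text \<open>The field \<open>'a\<close> is left open so that the same real components can be
  evaluated at real and at complex momenta. Restricting to lists of length \<open>m\<close> extracts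
  one homogeneous part, as a \<open>tensor\<close> lives in the whole tensor algebra.\<close>

definition tensor_poly :: "nat \<Rightarrow> 'n::finite tensor \<Rightarrow> ('n \<Rightarrow> 'a::real_normed_field) \<Rightarrow> 'a" where
  "tensor_poly m A \<xi> = (\<Sum>is | length is = m. of_real (A is) * prod_list (map \<xi> is))"

text \<open>Symmetry in all degrees at once. Multisets make the exchange of two indices and the
  fixing of the first one immediate; \<open>perm_invariant_iff\<close> gives the agreement with the
  permutations in \<open>sym_tensor\<close>.\<close>

definition perm_invariant :: "'n tensor \<Rightarrow> bool" where
  "perm_invariant A \<longleftrightarrow> (\<forall>is js. mset is = mset js \<longrightarrow> A is = A js)"

lemma finite_lists_length [simp]: "finite {is :: 'n::finite list. length is = m}"
  using finite_lists_length_eq[of "UNIV :: 'n set" m] by simp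

lemma tensor_poly_0: "tensor_poly 0 A \<xi> = of_real (A [])"
  by (simp add: tensor_poly_def)

lemma tensor_poly_Suc:
  fixes A :: "'n::finite tensor"
  shows "tensor_poly (Suc m) A \<xi> = (\<Sum>i\<in>UNIV. \<xi> i * tensor_poly m (\<lambda>is. A (i # is)) \<xi>)"
proof -
  have eq: "{is :: 'n list. length is = Suc m} = (\<lambda>(i, is). i # is) ` (UNIV \<times> {is. length is = m})"
    by (auto simp: length_Suc_conv image_iff)
  have "inj_on (\<lambda>(i :: 'n, is). i # is) (UNIV \<times> {is. length is = m})"
    by (auto simp: inj_on_def)
  then show ?thesis
    unfolding tensor_poly_def sum_distrib_left sum.cartesian_product eq
    by (subst sum.reindex) (auto simp: mult_ac intro!: sum.cong)
qed

lemma tensor_poly_add: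
  "tensor_poly m (\<lambda>is. A is + B is) \<xi> = tensor_poly m A \<xi> + tensor_poly m B \<xi>"
  by (simp add: tensor_poly_def sum.distrib algebra_simps)

lemma tensor_poly_scale: "tensor_poly m (\<lambda>is. c * A is) \<xi> = of_real c * tensor_poly m A \<xi>"
  by (simp add: tensor_poly_def sum_distrib_left algebra_simps)

lemma tensor_poly_sum:
  "tensor_poly m (\<lambda>is. \<Sum>j\<in>S. A j is) \<xi> = (\<Sum>j\<in>S. tensor_poly m (A j) \<xi>)"
  by (simp add: tensor_poly_def sum_distrib_right) (rule sum.swap)

lemma tensor_poly_zero: "(\<And>is. length is = m \<Longrightarrow> A is = 0) \<Longrightarrow> tensor_poly m A \<xi> = 0"
  by (simp add: tensor_poly_def)

lemma perm_invariant_Cons: "perm_invariant A \<Longrightarrow> perm_invariant (\<lambda>is. A (i # is))"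
  by (simp add: perm_invariant_def)

lemma perm_invariant_swap: "perm_invariant A \<Longrightarrow> A (i # j # is) = A (j # i # is)"
  by (simp add: perm_invariant_def add_mset_commute)

lemma perm_invariant_iff:
  "perm_invariant A \<longleftrightarrow> (\<forall>is \<sigma>. \<sigma> permutes {..<length is} \<longrightarrow> A (permute_list \<sigma> is) = A is)"
proof
  assume "perm_invariant A"
  then show "\<forall>is \<sigma>. \<sigma> permutes {..<length is} \<longrightarrow> A (permute_list \<sigma> is) = A is"
    unfolding perm_invariant_def by (metis mset_permute_list)
next
  assume *: "\<forall>is \<sigma>. \<sigma> permutes {..<length is} \<longrightarrow> A (permute_list \<sigma> is) = A is"
  show "perm_invariant A"
    unfolding perm_invariant_def
  proof (intro allI impI)
    fix "is" js :: "'a list"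
    assume "mset is = mset js"
    then obtain \<sigma> where "\<sigma> permutes {..<length js}" "permute_list \<sigma> js = is"
      by (rule mset_eq_permutation)
    then show "A is = A js"
      using * by auto
  qed
qed

text \<open>Permuting the argument by \<open>\<tau>\<close> only reindexes the sum over all
  permutations by \<open>\<sigma> \<mapsto> \<tau> \<circ> \<sigma>\<close>.\<close>

lemma perm_invariant_sym_prod: "perm_invariant (sym_prod A B)"
  unfolding perm_invariant_iff
proof (intro allI impI)
  fix "is" :: "'a list" and \<tau>
  assume \<tau>: "\<tau> permutes {..<length is}"
  have "(\<Sum>\<sigma> | \<sigma> permutes {..<length is}. g (permute_list \<sigma> (permute_list \<tau> is))) =
        (\<Sum>\<sigma> | \<sigma> permutes {..<length is}. g (permute_list \<sigma> is))" for g :: "'a list \<Rightarrow> real"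
    by (rule sum.reindex_bij_witness [where i = "\<lambda>\<sigma>. inv \<tau> \<circ> \<sigma>" and j = "\<lambda>\<sigma>. \<tau> \<circ> \<sigma>"])
      (auto simp: permute_list_compose permutes_compose permutes_inv permutes_inv_o [OF \<tau>] o_assoc \<tau>)
  then have "(\<Sum>\<sigma> | \<sigma> permutes {..<length is}. A (take k (permute_list \<sigma> (permute_list \<tau> is))) *
        B (drop k (permute_list \<sigma> (permute_list \<tau> is)))) =
      (\<Sum>\<sigma> | \<sigma> permutes {..<length is}. A (take k (permute_list \<sigma> is)) *
        B (drop k (permute_list \<sigma> is)))" for k
    by (rule meta_allE [where x = "\<lambda>is. A (take k is) * B (drop k is)"])
  then show "sym_prod A B (permute_list \<tau> is) = sym_prod A B is"
    by (simp add: sym_prod_def)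
qed

lemma sum_permute_list:
  fixes g :: "'n::finite list \<Rightarrow> 'b::comm_monoid_add"
  assumes "\<sigma> permutes {..<m}"
  shows "(\<Sum>is | length is = m. g (permute_list \<sigma> is)) = (\<Sum>is | length is = m. g is)"
proof (rule sum.reindex_bij_witness [where
      i = "permute_list (inv \<sigma>)" and j = "permute_list \<sigma>"])
  have i: "inv \<sigma> permutes {..<m}"
    using assms by (rule permutes_inv)
  show "permute_list (inv \<sigma>) (permute_list \<sigma> is) = is" if "is \<in> {is. length is =
      m}" for "is" :: "'n list"
    using that assms i by (simp add: permute_list_compose [symmetric] permutes_inv_o)
  show "permute_list \<sigma> (permute_list (inv \<sigma>) is) = is" if "is \<in> {is. length is =
      m}" for "is" :: "'n list"
    using that assms i by (simp add: permute_list_compose [symmetric] permutes_inv_o)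
qed auto

lemma sum_take_drop:
  fixes g h :: "'n::finite list \<Rightarrow> 'b::comm_semiring_0"
  assumes "k \<le> m"
  shows "(\<Sum>is | length is = m. g (take k is) * h (drop k is)) =
    (\<Sum>is | length is = k. g is) * (\<Sum>is | length is = m - k. h is)"
  unfolding sum_product sum.cartesian_product
  by (rule sum.reindex_bij_witness [where i = "\<lambda>(a, b). a @ b" and j = "\<lambda>is. (take k is, drop k is)"])
    (use assms in auto)

text \<open>The factor \<open>1 / fact m\<close> is forced by the normalisation of the symmetric product.\<close>

lemma tensor_poly_sym_prod:
  "tensor_poly m (sym_prod A B) \<xi> / fact m =
    (\<Sum>k\<le>m. tensor_poly k A \<xi> / fact k * (tensor_poly (m - k) B \<xi> / fact (m - k)))"
proof -
  have "(\<Sum>is | length is = m. of_real (A (take k (permute_list \<sigma> is)) * B (drop k (permute_list \<sigma>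
      is))) *
      prod_list (map \<xi> is)) = tensor_poly k A \<xi> * tensor_poly (m - k) B \<xi>"
    if "k \<le> m" and \<sigma>: "\<sigma> permutes {..<m}" for k \<sigma>
  proof -
    \<comment> \<open>A monomial ignores the order of its factors, so \<open>\<sigma>\<close> can
      act on the whole summand and be removed by reindexing. Hence all \<open>fact m\<close>
      permutations contribute equally.\<close>
    have pl: "prod_list (map \<xi> (permute_list \<sigma> is)) = prod_list (map \<xi> is)" if "length is = m" for "is"
      using that \<sigma> by (metis mset_map mset_permute_list prod_mset_prod_list)
    have "(\<Sum>is | length is = m. of_real (A (take k (permute_list \<sigma> is)) * B (drop k (permute_list \<sigma>
        is))) *
        prod_list (map \<xi> is)) =
      (\<Sum>is | length is = m. of_real (A (take k (permute_list \<sigma> is)) * B (drop k (permute_list \<sigma> is))) *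
        prod_list (map \<xi> (permute_list \<sigma> is)))"
      by (rule sum.cong) (simp_all add: pl)
    also have "\<dots> = (\<Sum>is | length is = m. of_real (A (take k is) * B (drop k is)) * prod_list (map \<xi>
        is))"
      by (rule sum_permute_list [OF \<sigma>])
    also have "\<dots> = (\<Sum>is | length is = m. (of_real (A (take k is)) * prod_list (map \<xi> (take k is))) *
        (of_real (B (drop k is)) * prod_list (map \<xi> (drop k is))))"
      by (intro sum.cong refl)
        (metis (no_types, lifting) append_take_drop_id map_append mult.assoc mult.left_commute
            of_real_mult
          prod_list.append)
    also have "\<dots> = tensor_poly k A \<xi> * tensor_poly (m - k) B \<xi>"
      unfolding tensor_poly_def by (rule sum_take_drop [OF \<open>k \<le> m\<close>])
    finally show ?thesis .
  qed
  note key = this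
  have "tensor_poly m (sym_prod A B) \<xi> =
    (\<Sum>is | length is = m. \<Sum>k\<le>m. \<Sum>\<sigma> | \<sigma> permutes {..<m}.
      of_real (A (take k (permute_list \<sigma> is)) * B (drop k (permute_list \<sigma> is))) * prod_list (map \<xi> is)
       / (fact k * fact (m - k)))"
    unfolding tensor_poly_def sym_prod_def
    by (intro sum.cong refl) (simp add: sum_distrib_right sum_divide_distrib)
  also have "\<dots> = (\<Sum>k\<le>m. \<Sum>\<sigma> | \<sigma> permutes {..<m}. \<Sum>is | length is = m.
      of_real (A (take k (permute_list \<sigma> is)) * B (drop k (permute_list \<sigma> is))) * prod_list (map \<xi> is)
       / (fact k * fact (m - k)))"
    by (subst sum.swap, rule sum.cong [OF refl], rule sum.swap)
  also have "\<dots> = (\<Sum>k\<le>m. \<Sum>\<sigma> | \<sigma> permutes {..<m}.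
      tensor_poly k A \<xi> * tensor_poly (m - k) B \<xi> / (fact k * fact (m - k)))"
    by (intro sum.cong refl) (simp add: sum_divide_distrib [symmetric] key del: of_real_mult)
  also have "\<dots> = fact m * (\<Sum>k\<le>m. tensor_poly k A \<xi> / fact k * (tensor_poly (m - k) B \<xi> / fact (m - k)))"
    by (simp add: card_permutations sum_distrib_left)
  finally show ?thesis
    by simp
qed

text \<open>Components and momenta both vary with \<open>z\<close>. By symmetry each of the
  \<open>m\<close> slots contributes the same contraction to the derivative in the momenta, hence
  the factor \<open>of_nat m\<close> and the index \<open>i\<close> in first place.\<close>

lemma has_derivative_tensor_poly:
  fixes \<xi> :: "'b::real_normed_vector \<Rightarrow> 'n::finite \<Rightarrow> 'a::real_normed_field"
  assumes "perm_invariant (A z)"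
    and "\<And>is. ((\<lambda>z. A z is) has_derivative A' is) (at z)"
    and "\<And>i. ((\<lambda>z. \<xi> z i) has_derivative \<xi>' i) (at z)"
  shows "((\<lambda>z. tensor_poly m (A z) (\<xi> z)) has_derivative
     (\<lambda>v. tensor_poly m (\<lambda>is. A' is v) (\<xi> z) +
        of_nat m * (\<Sum>i\<in>UNIV. \<xi>' i v * tensor_poly (m - 1) (\<lambda>is. A z (i # is)) (\<xi> z)))) (at z)"
  using assms(1,2)
proof (induction m arbitrary: A A')
  case 0
  show ?case
    using 0(2) by (auto simp: tensor_poly_0 intro!: derivative_eq_intros)
next
  case (Suc m)
  have IH: "((\<lambda>z. tensor_poly m (\<lambda>is. A z (i # is)) (\<xi> z)) has_derivative
     (\<lambda>v. tensor_poly m (\<lambda>is. A' (i # is) v) (\<xi> z) +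
        of_nat m * (\<Sum>j\<in>UNIV. \<xi>' j v * tensor_poly (m -
            Suc 0) (\<lambda>is. A z (i # j # is)) (\<xi> z)))) (at z)" for i
    unfolding One_nat_def [symmetric] by (rule Suc.IH) (use Suc.prems in \<open>auto intro:
        perm_invariant_Cons\<close>)
  \<comment> \<open>Contracting one more slot restores degree \<open>m\<close>. For
    \<open>m = 0\<close> the truncated \<open>m - Suc 0\<close> does no harm, because the factor
    \<open>of_nat m\<close> vanishes.\<close>
  have *: "of_nat m * (\<Sum>i\<in>UNIV. \<xi> z i * tensor_poly (m - Suc 0) (\<lambda>is. A z (i # j # is)) (\<xi> z)) =
      of_nat m * tensor_poly m (\<lambda>is. A z (j # is)) (\<xi> z)" for j
    by (cases m) (simp_all add: tensor_poly_Suc perm_invariant_swap [OF Suc.prems(1), of j])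
  have **: "(\<Sum>i\<in>UNIV. \<xi> z i * (of_nat m * (\<Sum>j\<in>UNIV. \<xi>' j v * tensor_poly (m -
      Suc 0) (\<lambda>is. A z (i # j # is)) (\<xi> z)))) =
    of_nat m * (\<Sum>j\<in>UNIV. \<xi>' j v * tensor_poly m (\<lambda>is. A z (j # is)) (\<xi> z))" (is "?l = ?r") for v
  proof -
    have "?l = (\<Sum>j\<in>UNIV. \<xi>' j v * (of_nat m * (\<Sum>i\<in>UNIV. \<xi> z i * tensor_poly (m -
        Suc 0) (\<lambda>is. A z (i # j # is)) (\<xi> z))))"
      unfolding sum_distrib_left by (subst sum.swap) (simp add: mult_ac)
    then show ?thesis
      unfolding * by (simp add: sum_distrib_left mult_ac)
  qed
  show ?case
    unfolding tensor_poly_Suc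
    by (rule has_derivative_eq_rhs,
        rule has_derivative_sum, rule has_derivative_mult [OF assms(3) IH])
      (auto simp: fun_eq_iff sum.distrib ring_distribs ** tensor_poly_Suc)
qed

text \<open>Polarisation: differentiating the polynomial in the variable \<open>\<xi> j\<close>
  gives \<open>Suc m\<close> times the polynomial of the contraction with \<open>j\<close>, so
  induction strips off one index at a time.\<close>

lemma tensor_poly_inject_zero:
  fixes A :: "'n::finite tensor"
  assumes "perm_invariant A" and "\<And>\<xi> :: 'n \<Rightarrow> real. tensor_poly m A \<xi> = 0" and "length is = m"
  shows "A is = 0"
  using assms
proof (induction m arbitrary: A "is")
  case 0
  then show ?case
    by (simp add: tensor_poly_0)
next
  case (Suc m)
  obtain j js where "is": "is = j # js" "length js = m"
    using Suc.prems(3) by (auto simp: length_Suc_conv)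
  have "tensor_poly m (\<lambda>is. A (j # is)) \<xi> = 0" for \<xi> :: "'n \<Rightarrow> real"
  proof -
    let ?\<xi> = "\<lambda>t i. \<xi> i + (if i = j then t else 0)"
    have \<xi>': "((\<lambda>t. ?\<xi> t i) has_derivative (\<lambda>t. if i = j then t else 0)) (at 0)" for i
      by (cases "i = j") (auto intro!: derivative_eq_intros)
    have "((\<lambda>t. tensor_poly (Suc m) A (?\<xi> t)) has_derivative
     (\<lambda>v. tensor_poly (Suc m) (\<lambda>is. 0) (?\<xi> 0) +
        of_nat (Suc m) * (\<Sum>i\<in>UNIV. (if i = j then v else 0) * tensor_poly (Suc m -
            1) (\<lambda>is. A (i # is)) (?\<xi> 0)))) (at 0)"
      by (rule has_derivative_tensor_poly)
        (use Suc.prems(1) \<xi>' in auto)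
    moreover have "((\<lambda>t. tensor_poly (Suc m) A (?\<xi> t)) has_derivative (\<lambda>v. 0)) (at 0)"
      by (simp add: Suc.prems(2))
    ultimately have "(\<lambda>v. tensor_poly (Suc m) (\<lambda>is. 0) (?\<xi> 0) +
        of_nat (Suc m) * (\<Sum>i\<in>UNIV. (if i = j then v else 0) * tensor_poly (Suc m -
            1) (\<lambda>is. A (i # is)) (?\<xi> 0))) 
        = (\<lambda>v. 0)"
      by (rule has_derivative_unique)
    from fun_cong [OF this, of 1] show ?thesis
      by (simp add: tensor_poly_zero if_distrib [of "\<lambda>x. x * _"] cong: if_cong)
  qed
  then show ?case
    unfolding "is"(1) by (intro Suc.IH [OF perm_invariant_Cons [OF Suc.prems(1)]] "is"(2))
qed

lemma tensor_poly_scalar_tensor: "tensor_poly m (scalar_tensor c) \<xi> = (if m = 0 then of_real c else 0)"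
  by (cases m) (simp_all add: tensor_poly_0 tensor_poly_Suc scalar_tensor_def tensor_poly_zero)

lemma tensor_poly_vec_tensor:
  "tensor_poly m (vec_tensor v) \<xi> = (if m = 1 then (\<Sum>i\<in>UNIV. of_real (v $ i) * \<xi> i) else 0)"
proof (cases m)
  case (Suc k)
  then show ?thesis
    by (cases k) (simp_all add: tensor_poly_0 tensor_poly_Suc vec_tensor_def tensor_poly_zero
        mult.commute)
qed (simp add: tensor_poly_0 vec_tensor_def)

lemma perm_invariant_add:
  "perm_invariant A \<Longrightarrow> perm_invariant B \<Longrightarrow> perm_invariant (\<lambda>is. A is + B is)"
  unfolding perm_invariant_def by metis

lemma perm_invariant_scalar_tensor: "perm_invariant (scalar_tensor c)"
  unfolding perm_invariant_def scalar_tensor_def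
  by (auto split: list.split)

lemma perm_invariant_vec_tensor: "perm_invariant (vec_tensor v)"
  unfolding perm_invariant_def
proof (intro allI impI)
  fix "is" js :: "'a list"
  assume "mset is = mset js"
  moreover from this have "length is = length js"
    by (rule mset_eq_length)
  ultimately show "vec_tensor v is = vec_tensor v js"
    by (auto simp: vec_tensor_def split: list.splits)
qed

subsection \<open>Killing tensors of a conformally flat metric\<close>

lemma matrix_inv_mat:
  fixes c :: real
  assumes "c \<noteq> 0"
  shows "matrix_inv (mat c :: real^'n^'n) = mat (1 / c)"
proof -
  have m: "mat a ** mat b = (mat (a * b) :: real^'n^'n)" for a b :: real
    by (simp add: vec_eq_iff matrix_matrix_mult_def mat_def if_distrib [of "\<lambda>x. x * _"] cong: if_cong)
  have "(mat c :: real^'n^'n) ** mat (1 / c) = mat 1 \<and> mat (1 / c) ** (mat c :: real^'n^'n) = mat 1"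
    using assms by (simp add: m)
  then have "matrix_inv (mat c) ** (mat c :: real^'n^'n) = mat 1"
    unfolding matrix_inv_def by (rule someI2) simp
  then have "matrix_inv (mat c) ** ((mat c :: real^'n^'n) ** mat (1 / c)) = mat (1 / c)"
    by (simp add: matrix_mul_assoc)
  then show ?thesis
    using assms by (simp add: m)
qed

lemma metric_tensor_conformal:
  fixes x :: "real^'n::finite"
  shows "metric_tensor (conformal_metric f) x is =
    (case is of [i, j] \<Rightarrow> if i = j then exp (- 2 * f x) else 0 | _ \<Rightarrow> 0)"
proof -
  have "matrix_inv (conformal_metric f x) = (mat (exp (- 2 * f x)) :: real^'n^'n)"
    by (simp add: conformal_metric_def matrix_inv_mat exp_minus inverse_eq_divide)
  then show ?thesis
    by (simp add: metric_tensor_def mat_def split: list.split)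
qed

lemma perm_invariant_metric_tensor_conformal: "perm_invariant (metric_tensor (conformal_metric f) x)"
  unfolding perm_invariant_def
proof (intro allI impI)
  fix "is" js :: "'a list"
  assume "mset is = mset js"
  moreover from this have "length is = length js"
    by (rule mset_eq_length)
  ultimately show "metric_tensor (conformal_metric f) x is = metric_tensor (conformal_metric f) x js"
    by (auto simp: metric_tensor_conformal add_eq_conv_ex split: list.splits)
qed

lemma tensor_poly_metric_tensor_conformal:
  "tensor_poly m (metric_tensor (conformal_metric f) x) \<xi> =
    (if m = 2 then of_real (exp (- 2 * f x)) * (\<Sum>i\<in>UNIV. \<xi> i ^ 2) else 0)"
proof (cases "m = 2")
  case True
  have "tensor_poly (Suc (Suc 0)) (metric_tensor (conformal_metric f) x) \<xi> =
    (\<Sum>i\<in>UNIV. \<xi> i * (\<Sum>j\<in>UNIV. \<xi> j * of_real (if i = j then exp (- 2 * f x) else 0)))"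
    by (simp add: tensor_poly_Suc tensor_poly_0 metric_tensor_conformal)
  also have "\<dots> = of_real (exp (- 2 * f x)) * (\<Sum>i\<in>UNIV. \<xi> i ^ 2)"
    by (simp add: if_distrib [of of_real] if_distrib [of "(*) _"] sum_distrib_left sum_distrib_right
        power2_eq_square mult_ac cong: if_cong)
  finally show ?thesis
    using True by (simp add: numeral_2_eq_2)
next
  case False
  then have "tensor_poly m (metric_tensor (conformal_metric f) x) \<xi> = 0"
    by (intro tensor_poly_zero) (auto simp: metric_tensor_conformal split: list.split)
  with False show ?thesis
    by simp
qed

text \<open>\<open>q\<close> is the function on the cotangent bundle belonging to a homogeneous
  member of \<open>polynomials_in G\<close> of degree \<open>m\<close>. Division by
  \<open>fact k\<close> turns the symmetric product into the pointwise product of functions; ranging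
  over all \<open>k\<close> forces the parts of other degrees to vanish.\<close>

definition polynomial_symbol ::
    "'n::finite tensor_field set \<Rightarrow> nat \<Rightarrow> (real^'n \<Rightarrow> ('n \<Rightarrow> real) \<Rightarrow> real) \<Rightarrow> bool" where
  "polynomial_symbol G m q \<longleftrightarrow> (\<exists>Z \<in> polynomials_in G. \<forall>x. perm_invariant (Z x) \<and>
     (\<forall>k \<xi>. tensor_poly k (Z x) \<xi> / fact k = (if k = m then q x \<xi> else 0)))"

lemma polynomial_symbol_const: "polynomial_symbol G 0 (\<lambda>x \<xi>. c)"
  unfolding polynomial_symbol_def
  by (rule bexI [OF _ polynomials_in.const [of c]])
    (auto simp: perm_invariant_scalar_tensor tensor_poly_scalar_tensor)

lemma polynomial_symbol_zero: "polynomial_symbol G m (\<lambda>x \<xi>. 0)"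
  unfolding polynomial_symbol_def
  by (rule bexI [OF _ polynomials_in.const [of 0]])
    (auto simp: perm_invariant_scalar_tensor tensor_poly_scalar_tensor)

lemma polynomial_symbol_add:
  assumes "polynomial_symbol G m q" "polynomial_symbol G m r"
  shows "polynomial_symbol G m (\<lambda>x \<xi>. q x \<xi> + r x \<xi>)"
proof -
  obtain Y where Y: "Y \<in> polynomials_in G" "\<forall>x. perm_invariant (Y x) \<and>
     (\<forall>k \<xi>. tensor_poly k (Y x) \<xi> / fact k = (if k = m then q x \<xi> else 0))"
    using assms(1) unfolding polynomial_symbol_def by (elim bexE)
  obtain Z where Z: "Z \<in> polynomials_in G" "\<forall>x. perm_invariant (Z x) \<and>
     (\<forall>k \<xi>. tensor_poly k (Z x) \<xi> / fact k = (if k = m then r x \<xi> else 0))"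
    using assms(2) unfolding polynomial_symbol_def by (elim bexE)
  show ?thesis
    unfolding polynomial_symbol_def
    by (rule bexI [OF _ polynomials_in.add [OF Y(1) Z(1)]])
      (use Y(2) Z(2) in \<open>simp add: tensor_poly_add add_divide_distrib perm_invariant_add\<close>)
qed

lemma polynomial_symbol_mult:
  assumes "polynomial_symbol G m q" "polynomial_symbol G n r"
  shows "polynomial_symbol G (m + n) (\<lambda>x \<xi>. q x \<xi> * r x \<xi>)"
proof -
  obtain Y where Y: "Y \<in> polynomials_in G" "\<forall>x. perm_invariant (Y x) \<and>
     (\<forall>k \<xi>. tensor_poly k (Y x) \<xi> / fact k = (if k = m then q x \<xi> else 0))"
    using assms(1) unfolding polynomial_symbol_def by (elim bexE)
  obtain Z where Z: "Z \<in> polynomials_in G" "\<forall>x. perm_invariant (Z x) \<and>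
     (\<forall>k \<xi>. tensor_poly k (Z x) \<xi> / fact k = (if k = n then r x \<xi> else 0))"
    using assms(2) unfolding polynomial_symbol_def by (elim bexE)
  note Yp = Y(2) [rule_format, THEN conjunct2, rule_format]
    and Zp = Z(2) [rule_format, THEN conjunct2, rule_format]
  have "tensor_poly k (sym_prod (Y x) (Z x)) \<xi> / fact k = (if k = m +
      n then q x \<xi> * r x \<xi> else 0)" for x k \<xi>
  proof -
    \<comment> \<open>Homogeneity leaves only the term \<open>j = m\<close> of the convolution, and
      that one only if \<open>k - j = n\<close>.\<close>
    have "tensor_poly k (sym_prod (Y x) (Z x)) \<xi> / fact k =
        (\<Sum>j\<le>k. if j = m then (if k = m + n then q x \<xi> * r x \<xi> else 0) else 0)"
      unfolding tensor_poly_sym_prod Yp Zp by (intro sum.cong) auto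
    then show ?thesis
      by simp
  qed
  then show ?thesis
    unfolding polynomial_symbol_def
    by (intro bexI [OF _ polynomials_in.mult [OF Y(1) Z(1)]] allI conjI perm_invariant_sym_prod)
qed

lemma polynomial_symbol_scale:
  "polynomial_symbol G m q \<Longrightarrow> polynomial_symbol G m (\<lambda>x \<xi>. c * q x \<xi>)"
  using polynomial_symbol_mult [OF polynomial_symbol_const] by fastforce

lemma polynomial_symbol_sum:
  assumes "\<And>a. a \<in> S \<Longrightarrow> polynomial_symbol G m (q a)"
  shows "polynomial_symbol G m (\<lambda>x \<xi>. \<Sum>a\<in>S. q a x \<xi>)"
  using assms
  by (induction S rule: infinite_finite_induct) (simp_all add: polynomial_symbol_zero
      polynomial_symbol_add)

lemma polynomial_symbol_power:
  "polynomial_symbol G m q \<Longrightarrow> polynomial_symbol G (m * n) (\<lambda>x \<xi>. q x \<xi> ^ n)"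
  by (induction n) (simp_all add: polynomial_symbol_const polynomial_symbol_mult)

lemma polynomial_symbol_coord_field:
  assumes "coord_field i \<in> G"
  shows "polynomial_symbol G 1 (\<lambda>x \<xi>. \<xi> i)"
  unfolding polynomial_symbol_def
  by (rule bexI [OF _ polynomials_in.gen [OF assms]])
    (simp add: coord_field_def perm_invariant_vec_tensor tensor_poly_vec_tensor axis_def
      if_distrib [of "\<lambda>x. x * _"] cong: if_cong)

text \<open>The denominator is \<open>fact 2\<close>; the symbol is the Hamiltonian of the geodesic
  flow.\<close>

lemma polynomial_symbol_metric_tensor:
  assumes "metric_tensor (conformal_metric f) \<in> G"
  shows "polynomial_symbol G 2 (\<lambda>x \<xi>. exp (- 2 * f x) * (\<Sum>i\<in>UNIV. \<xi> i ^ 2) / 2)"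
  unfolding polynomial_symbol_def
  by (rule bexI [OF _ polynomials_in.gen [OF assms]])
    (simp add: perm_invariant_metric_tensor_conformal tensor_poly_metric_tensor_conformal)

lemma sym_tensor_imp_perm_invariant: "sym_tensor p A \<Longrightarrow> perm_invariant A"
  by (simp add: sym_tensor_def perm_invariant_iff)

text \<open>Symmetric tensors are determined by their polynomials, so membership can be decided on
  functions of the momenta: the witness \<open>Z\<close> agrees with \<open>K\<close> in degree
  \<open>p\<close>, and both vanish in every other degree.\<close>

lemma polynomials_inI:
  fixes K :: "'n::finite tensor_field"
  assumes "polynomial_symbol G p (\<lambda>x \<xi>. tensor_poly p (K x) \<xi> / fact p)"
    and "\<And>x. sym_tensor p (K x)"
  shows "K \<in> polynomials_in G"
proof -
  obtain Z where Z: "Z \<in> polynomials_in G" "\<forall>x. perm_invariant (Z x) \<and>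
     (\<forall>k (\<xi> :: 'n \<Rightarrow> real). tensor_poly k (Z x) \<xi> / fact k =
       (if k = p then tensor_poly p (K x) \<xi> / fact p else 0))"
    using assms(1) unfolding polynomial_symbol_def by (elim bexE)
  have "Z x is + - 1 * K x is = 0" for x "is"
  proof (rule tensor_poly_inject_zero [where A = "\<lambda>is. Z x is + - 1 * K x is", OF _ _ refl])
    show "perm_invariant (\<lambda>is. Z x is + - 1 * K x is)"
      using Z(2) sym_tensor_imp_perm_invariant [OF assms(2) [of x]]
      unfolding perm_invariant_def by metis
    have "tensor_poly k (K x) \<xi> = 0" if "k \<noteq> p" for k and \<xi> :: "'n \<Rightarrow> real"
      using assms(2) [of x] that by (intro tensor_poly_zero) (simp add: sym_tensor_def)
    then show "tensor_poly (length is) (\<lambda>is. Z x is + - 1 * K x is) \<xi> = 0" for \<xi> :: "'n \<Rightarrow> real"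
      using Z(2) [rule_format, THEN conjunct2, rule_format, of "length is" x \<xi>]
      unfolding tensor_poly_add tensor_poly_scale by (cases "length is = p") auto
  qed
  then have "K = Z"
    by (auto simp: fun_eq_iff)
  with Z(1) show ?thesis
    by simp
qed

text \<open>The Christoffel terms of the covariant derivative act on polynomials as a derivation.\<close>

lemma tensor_poly_derivation:
  assumes "perm_invariant A"
  shows "tensor_poly m (\<lambda>is. \<Sum>r<length is. \<Sum>j\<in>UNIV. c (is ! r) j * A (is[r := j])) \<xi> =
    of_nat m * (\<Sum>i\<in>UNIV. \<Sum>j\<in>UNIV. of_real (c i j) * \<xi> i * tensor_poly (m - 1) (\<lambda>is. A (j # is)) \<xi>)"
  using assms
proof (induction m arbitrary: A)
  case 0
  then show ?case
    by (simp add: tensor_poly_0)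
next
  case (Suc m)
  have "tensor_poly (Suc m) (\<lambda>is. \<Sum>r<length is. \<Sum>j\<in>UNIV. c (is ! r) j * A (is[r := j])) \<xi> =
    (\<Sum>i\<in>UNIV. \<xi> i * ((\<Sum>j\<in>UNIV. of_real (c i j) * tensor_poly m (\<lambda>is. A (j # is)) \<xi>) +
      tensor_poly m (\<lambda>is. \<Sum>r<length is. \<Sum>j\<in>UNIV. c (is ! r) j * A (i # is[r := j])) \<xi>))"
    by (simp add: tensor_poly_Suc sum.lessThan_Suc_shift tensor_poly_add tensor_poly_sum
        tensor_poly_scale
        del: sum.lessThan_Suc)
  also have "\<dots> = (\<Sum>i\<in>UNIV. \<Sum>j\<in>UNIV. of_real (c i j) * \<xi> i * tensor_poly m (\<lambda>is. A (j # is)) \<xi>) +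
     (\<Sum>i\<in>UNIV. \<xi> i * tensor_poly m (\<lambda>is. \<Sum>r<length is. \<Sum>j\<in>UNIV. c (is ! r) j * A (i # is[r := j])) \<xi>)"
    by (simp add: ring_distribs sum.distrib sum_distrib_left mult_ac)
  \<comment> \<open>These are the slots after the first. The induction hypothesis is applied to the
    contraction with \<open>k\<close>; symmetry exchanges \<open>k\<close> and \<open>j\<close>, so
    that the sum over \<open>k\<close> is absorbed into a polynomial of degree
    \<open>m\<close>.\<close>
  also have "(\<Sum>i\<in>UNIV. \<xi> i * tensor_poly m (\<lambda>is. \<Sum>r<length is. \<Sum>j\<in>UNIV. c (is ! r) j * A (i # is[r
      := j])) \<xi>) =
     of_nat m * (\<Sum>i\<in>UNIV. \<Sum>j\<in>UNIV. of_real (c i j) * \<xi> i * tensor_poly m (\<lambda>is. A (j # is)) \<xi>)"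
  proof -
    have "tensor_poly m (\<lambda>is. \<Sum>r<length is. \<Sum>j\<in>UNIV. c (is ! r) j * A (k # is[r := j])) \<xi> =
      of_nat m * (\<Sum>i\<in>UNIV. \<Sum>j\<in>UNIV. of_real (c i j) * \<xi> i * tensor_poly (m -
          1) (\<lambda>is. A (k # j # is)) \<xi>)" for k
      by (rule Suc.IH [OF perm_invariant_Cons [OF Suc.prems]])
    then have "(\<Sum>k\<in>UNIV. \<xi> k * tensor_poly m (\<lambda>is. \<Sum>r<length is. \<Sum>j\<in>UNIV. c (is ! r) j * A (k # is[r
        := j])) \<xi>) =
      of_nat m * (\<Sum>k\<in>UNIV. \<Sum>i\<in>UNIV. \<Sum>j\<in>UNIV. of_real (c i j) * \<xi> i * (\<xi> k * tensor_poly (m -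
          1) (\<lambda>is. A (k # j # is)) \<xi>))"
      by (simp add: sum_distrib_left mult_ac)
    also have "\<dots> = of_nat m * (\<Sum>i\<in>UNIV. \<Sum>j\<in>UNIV. \<Sum>k\<in>UNIV. of_real (c i j) * \<xi> i * (\<xi> k * tensor_poly
        (m - 1) (\<lambda>is. A (k # j # is)) \<xi>))"
      by (rule arg_cong [where f = "(*) (of_nat m)"], rule trans [OF sum.swap],
          rule sum.cong [OF refl], rule sum.swap)
    also have "\<dots> = of_nat m * (\<Sum>i\<in>UNIV. \<Sum>j\<in>UNIV. of_real (c i j) * \<xi> i * tensor_poly m (\<lambda>is. A (j #
        is)) \<xi>)"
    proof (cases m)
      case (Suc n)
      have "A (k # j # is) = A (j # k # is)" for j k "is"
        by (rule perm_invariant_swap [OF Suc.prems])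
      then show ?thesis
        by (simp add: Suc tensor_poly_Suc sum_distrib_left)
    qed simp
    finally show ?thesis .
  qed
  finally show ?case
    by (simp add: ring_distribs)
qed

section \<open>The Levi-Civita connection and the conservation law\<close>

lemma partial_deriv_conformal_metric:
  assumes "f differentiable (at x)"
  shows "partial_deriv i (\<lambda>y. conformal_metric f y $ j $ m) x =
    (if j = m then 2 * exp (2 * f x) * partial_deriv i f x else 0)"
proof -
  have "(f has_derivative frechet_derivative f (at x)) (at x)"
    using assms by (simp add: frechet_derivative_works)
  then have "((\<lambda>y. exp (2 * f y)) has_derivative
      (\<lambda>v. exp (2 * f x) * (2 * frechet_derivative f (at x) v))) (at x)"
    by (auto intro!: derivative_eq_intros)
  from frechet_derivative_at [OF this, symmetric] show ?thesis
    by (simp add: partial_deriv_def conformal_metric_def mat_def)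
qed

lemma christoffel_conformal_metric:
  assumes "f differentiable (at x)"
  shows "christoffel (conformal_metric f) x k i j =
    (if j = k then partial_deriv i f x else 0) + (if i = k then partial_deriv j f x else 0)
     - (if i = j then partial_deriv k f x else 0)"
proof -
  have "matrix_inv (conformal_metric f x) $ k $ m = (if k = m then 1 / exp (2 * f x) else 0)" for m
    unfolding conformal_metric_def by (subst matrix_inv_mat) (simp_all add: mat_def)
  then have "christoffel (conformal_metric f) x k i j =
     1 / exp (2 * f x) * ((if j = k then 2 * exp (2 * f x) * partial_deriv i f x else 0) +
      (if i = k then 2 * exp (2 * f x) * partial_deriv j f x else 0) -
      (if i = j then 2 * exp (2 * f x) * partial_deriv k f x else 0)) / 2"
    unfolding christoffel_def partial_deriv_conformal_metric [OF assms]
    by (simp add: if_distrib [of "\<lambda>x. x * _"] cong: if_cong)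
  also have "\<dots> = (if j = k then partial_deriv i f x else 0) + (if i = k then partial_deriv j f x else 0)
     - (if i = j then partial_deriv k f x else 0)"
    by simp
  finally show ?thesis .
qed

lemma sum_delta_scaled:
  fixes X :: "'n::finite \<Rightarrow> 'a::comm_ring_1"
  shows "(\<Sum>j\<in>UNIV. c * (if j = i then 1 else 0) * X j) = c * X i"
  by (simp add: if_distrib [of "\<lambda>x. x * _"] if_distrib [of "(*) _"] cong: if_cong)

text \<open>Conservation of the polynomial under the geodesic flow of the Hamiltonian
  \<open>exp (- 2 * f x) * (\<Sum>i. \<xi> i ^ 2) / 2\<close>. Being an identity between tensors, it
  also holds for complex momenta.\<close>

lemma killing_tensor_conformal_imp:
  fixes \<xi> :: "'n::finite \<Rightarrow> 'a::real_normed_field"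
  assumes f: "f differentiable (at x)" and dep: "\<And>i. i \<noteq> l \<Longrightarrow> partial_deriv i f x = 0"
    and killing: "killing_tensor (conformal_metric f) p K"
  shows "(\<Sum>j\<in>UNIV. \<xi> j * tensor_poly p (\<lambda>is. partial_deriv j (\<lambda>y. K y is) x) \<xi>) +
    (\<Sum>j\<in>UNIV. \<xi> j ^ 2) * of_real (partial_deriv l f x) *
      (of_nat p * tensor_poly (p - 1) (\<lambda>is. K x (l # is)) \<xi>) = 0"
proof -
  \<comment> \<open>The rescaled coordinate frame is orthonormal, so the Killing equation may be
    tested on it.\<close>
  define e where "e i = exp (- f x) *\<^sub>R (axis i 1 :: real^'n)" for i
  define T where "T i is = partial_deriv i (\<lambda>y. K y is) x +
      (\<Sum>r<length is. \<Sum>m\<in>UNIV. christoffel (conformal_metric f) x (is ! r) i m * K x (is[r := m]))"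
          for i "is"
  define D where "D m = tensor_poly (p - 1) (\<lambda>is. K x (m # is)) \<xi>" for m
  define g :: "'n \<Rightarrow> 'a" where "g i = of_real (partial_deriv i f x)" for i
  have K: "perm_invariant (K x)"
    using killing by (auto simp: killing_tensor_def sym_tensor_field_def intro:
        sym_tensor_imp_perm_invariant)
  have "orthonormal_basis_at (conformal_metric f) x e"
  proof -
    have "mat c *v v = c *\<^sub>R v" for c and v :: "real^'n"
      by (simp add: vec_eq_iff matrix_vector_mult_def mat_def if_distrib [of "\<lambda>x. x * _"] cong: if_cong)
    moreover have "exp (2 * f x) * exp (- f x) * exp (- f x) = 1"
      by (simp flip: exp_add)
    ultimately show ?thesis
      by (simp add: orthonormal_basis_at_def e_def conformal_metric_def inner_axis_axis)
  qed
  then have zero: "(\<Sum>i\<in>UNIV. sym_prod (vec_tensor (e i)) (cov_deriv (conformal_metric f) (e i) K x)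
      is) = 0" for "is"
    using killing by (simp add: killing_tensor_def)
  have cov: "cov_deriv (conformal_metric f) (e i) K x = (\<lambda>is. exp (- f x) * T i is)" for i
    by (simp add: fun_eq_iff cov_deriv_def T_def e_def axis_def sum_delta_scaled)
  have vec: "tensor_poly k (vec_tensor (e i)) \<xi> = (if k =
      1 then of_real (exp (- f x)) * \<xi> i else 0)" for k i
    by (simp add: tensor_poly_vec_tensor e_def axis_def if_distrib [of of_real] sum_delta_scaled
        cong: if_cong)
  have prod: "tensor_poly (Suc p) (sym_prod (vec_tensor (e i)) (cov_deriv (conformal_metric f) (e i)
      K x)) \<xi> / fact (Suc p) =
    of_real (exp (- f x)) ^ 2 / fact p * (\<xi> i * tensor_poly p (T i) \<xi>)" for i
  proof -
    have "tensor_poly (Suc p) (sym_prod (vec_tensor (e i)) (cov_deriv (conformal_metric f) (e i) K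
        x)) \<xi> / fact (Suc p) =
      (\<Sum>k\<le>Suc p. if k = 1 then of_real (exp (- f x)) * \<xi> i * (of_real (exp (- f x)) * tensor_poly p
          (T i) \<xi> / fact p) else 0)"
      unfolding tensor_poly_sym_prod cov tensor_poly_scale vec by (intro sum.cong) auto
    then show ?thesis
      by (simp add: power2_eq_square)
  qed
  have "0 = tensor_poly (Suc p) (\<lambda>is. \<Sum>i\<in>UNIV. sym_prod (vec_tensor (e i)) (cov_deriv
      (conformal_metric f) (e i) K x) is) \<xi> / fact (Suc p)"
    by (simp add: zero tensor_poly_zero)
  also have "\<dots> = of_real (exp (- f x)) ^ 2 / fact p * (\<Sum>i\<in>UNIV. \<xi> i * tensor_poly p (T i) \<xi>)"
    unfolding tensor_poly_sum sum_divide_distrib prod by (simp only: sum_distrib_left)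
  finally have sum0: "(\<Sum>i\<in>UNIV. \<xi> i * tensor_poly p (T i) \<xi>) = 0"
    by simp
  have T: "tensor_poly p (T i) \<xi> = tensor_poly p (\<lambda>is. partial_deriv i (\<lambda>y. K y is) x) \<xi> +
      of_nat p * (\<Sum>k\<in>UNIV. \<Sum>m\<in>UNIV. of_real (christoffel (conformal_metric f) x k i m) * \<xi> k * D m)"
          for i
    unfolding T_def tensor_poly_add D_def
    by (subst tensor_poly_derivation [OF K, where c =
        "\<lambda>k m. christoffel (conformal_metric f) x k i m"]) simp
  have C: "of_real (christoffel (conformal_metric f) x k i m) =
    (if m = k then g i else 0) + (if i = k then g m else 0) - (if i = m then g k else 0)" for k i m
    by (simp add: christoffel_conformal_metric [OF f] g_def)
  have "(\<Sum>k\<in>UNIV. \<Sum>m\<in>UNIV. of_real (christoffel (conformal_metric f) x k i m) * \<xi> k * D m) =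
    g i * (\<Sum>k\<in>UNIV. \<xi> k * D k) + \<xi> i * (\<Sum>m\<in>UNIV. g m * D m) - D i * (\<Sum>k\<in>UNIV. g k * \<xi> k)" for i
  proof -
    have "(\<Sum>k\<in>UNIV. \<Sum>m\<in>UNIV. (if m = k then g i else 0) * \<xi> k * D m) = g i * (\<Sum>k\<in>UNIV. \<xi> k * D k)"
      by (simp add: if_distrib [of "\<lambda>x. x * _"] sum_distrib_left mult.assoc cong: if_cong)
    moreover have "(\<Sum>k\<in>UNIV. \<Sum>m\<in>UNIV. (if i = k then g m else 0) * \<xi> k * D m) =
        \<xi> i * (\<Sum>m\<in>UNIV. g m * D m)"
      by (subst sum.swap, simp add: if_distrib [of "\<lambda>x. x * _"] sum_distrib_left mult.assoc cong:
          if_cong)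
        (simp add: mult_ac)
    moreover have "(\<Sum>k\<in>UNIV. \<Sum>m\<in>UNIV. (if i = m then g k else 0) * \<xi> k * D m) =
        D i * (\<Sum>k\<in>UNIV. g k * \<xi> k)"
      by (simp add: if_distrib [of "\<lambda>x. x * _"] sum_distrib_left mult.assoc cong: if_cong)
        (simp add: mult_ac)
    ultimately show ?thesis
      unfolding C by (simp add: ring_distribs sum.distrib sum_subtractf)
  qed
  \<comment> \<open>With \<open>S1 = (\<Sum>k. \<xi> k * D k)\<close> and
    \<open>S3 = (\<Sum>k. g k * \<xi> k)\<close> the first and third terms cancel after contraction
    with \<open>\<xi>\<close>; only the term with the squared length of \<open>\<xi>\<close>
    survives.\<close>
  moreover have "(\<Sum>i\<in>UNIV. \<xi> i * (of_nat p * (g i * S1 + \<xi> i * S2 - D i * S3))) =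
    of_nat p * ((\<Sum>i\<in>UNIV. g i * \<xi> i) * S1 + (\<Sum>i\<in>UNIV. \<xi> i ^ 2) * S2 - (\<Sum>i\<in>UNIV. \<xi> i * D i) * S3)"
    for S1 S2 S3
    by (simp add: algebra_simps sum.distrib sum_subtractf sum_distrib_left power2_eq_square)
  ultimately have "(\<Sum>i\<in>UNIV. \<xi> i * (of_nat p * (\<Sum>k\<in>UNIV. \<Sum>m\<in>UNIV.
      of_real (christoffel (conformal_metric f) x k i m) * \<xi> k * D m))) =
    of_nat p * ((\<Sum>i\<in>UNIV. \<xi> i ^ 2) * (\<Sum>m\<in>UNIV. g m * D m))"
    by simp
  also have "(\<Sum>m\<in>UNIV. g m * D m) = (\<Sum>m\<in>UNIV. if m = l then g l * D l else 0)"
    using dep by (intro sum.cong) (auto simp: g_def)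
  finally show ?thesis
    using sum0 unfolding T by (simp add: ring_distribs sum.distrib g_def D_def mult_ac)
qed

subsection \<open>Flows and periodic functions\<close>

text \<open>Separation of variables: \<open>\<theta>\<close> is the inverse of an antiderivative
  \<open>G\<close> of \<open>1 / v\<close>. The bound \<open>M\<close> makes \<open>G\<close> grow
  at least linearly, so \<open>G\<close> is onto and \<open>\<theta>\<close> exists for all times;
  \<open>\<theta>\<close> is onto because \<open>G\<close> is defined on the whole line.\<close>

lemma exists_global_flow:
  fixes v :: "real \<Rightarrow> real"
  assumes cont: "\<And>t. isCont v t" and pos: "\<And>t. 0 < v t" and bound: "\<And>t. v t \<le> M"
  obtains \<theta> where "\<And>\<tau>. (\<theta> has_real_derivative v (\<theta> \<tau>)) (at \<tau>)" and "surj \<theta>"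
proof -
  have "\<exists>G. \<forall>t. -\<infinity> < ereal t \<longrightarrow> ereal t < \<infinity> \<longrightarrow> (G has_vector_derivative 1 / v t) (at t)"
    by (rule einterval_antiderivative) (use cont pos in \<open>auto intro!: continuous_intros simp:
        less_imp_neq [symmetric]\<close>)
  then obtain G where G: "\<And>t. (G has_real_derivative 1 / v t) (at t)"
    by (auto simp: has_real_derivative_iff_has_vector_derivative)
  have M: "0 < M"
    using pos [of 0] bound [of 0] by linarith
  have growth: "(b - a) / M \<le> G b - G a" if "a < b" for a b
  proof -
    obtain z where "G b - G a = (b - a) * (1 / v z)"
      using MVT2 [OF \<open>a < b\<close>, of G "\<lambda>t. 1 / v t"] G by auto
    moreover have "1 / M \<le> 1 / v z"
      using pos [of z] bound [of z] by (simp add: frac_le)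
    ultimately show ?thesis
      using mult_left_mono [of "1 / M" "1 / v z" "b - a"] that by simp
  qed
  have "strict_mono G"
  proof (rule strict_monoI)
    show "G a < G b" if "a < b" for a b
      using growth [OF that] M that divide_pos_pos [of "b - a" M] by linarith
  qed
  then have inj: "inj G"
    by (rule strict_mono_imp_inj_on)
  have Gcont: "isCont G t" for t
    using G DERIV_isCont by blast
  have surj: "surj G"
    unfolding surj_def
  proof
    fix s
    \<comment> \<open>Chosen so that \<open>T / M = \<bar>s - G 0\<bar> + 1\<close>: by the growth
      bound \<open>G\<close> passes \<open>s\<close> between \<open>- T\<close> and
      \<open>T\<close>.\<close>
    define T where "T = M * \<bar>s - G 0\<bar> + M"
    have T: "0 < T" "\<bar>s - G 0\<bar> \<le> T / M"
      using M by (auto simp: T_def add_divide_distrib intro!: add_nonneg_pos)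
    have "G (- T) \<le> s" "s \<le> G T"
      using growth [of "- T" 0] growth [of 0 T] T by auto
    then show "\<exists>t. s = G t"
      using IVT [of G "- T" s T] Gcont T by auto
  qed
  define \<theta> where "\<theta> = inv G"
  have G\<theta>: "G (\<theta> \<tau>) = \<tau>" and \<theta>G: "\<theta> (G t) = t" for \<tau> t
    by (simp_all add: \<theta>_def surj surj_f_inv_f inj)
  have "isCont \<theta> (G (\<theta> \<tau>))" for \<tau>
    by (rule isCont_inverse_function [of 1]) (auto simp: \<theta>G Gcont)
  then have \<theta>cont: "isCont \<theta> \<tau>" for \<tau>
    by (simp add: G\<theta>)
  have "(\<theta> has_real_derivative v (\<theta> \<tau>)) (at \<tau>)" for \<tau>
    using DERIV_inverse_function [OF G, where g = \<theta> and x = \<tau> and a = "\<tau> - 1" and b = "\<tau> + 1"]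
      G\<theta> \<theta>cont pos [of "\<theta> \<tau>"] by (auto simp: less_imp_neq [symmetric])
  moreover have "surj \<theta>"
    by (metis \<theta>G surjI)
  ultimately show thesis
    by (rule that)
qed

lemma periodic_integer_shift:
  fixes u :: "real^'n \<Rightarrow> 'b"
  assumes per: "\<And>x i. u (x + axis i 1) = u x" and m: "\<And>i. m $ i \<in> \<int>"
  shows "u (x + m) = u x"
proof -
  have nat: "u (x + real k *\<^sub>R axis i 1) = u x" for k x i
  proof (induction k)
    case (Suc k)
    have "x + real (Suc k) *\<^sub>R axis i 1 = (x + real k *\<^sub>R axis i 1) + axis i 1"
      by (simp add: algebra_simps)
    with per Suc show ?case
      by metis
  qed simp
  have int: "u (x + real_of_int k *\<^sub>R axis i 1) = u x" for k x i
  proof (cases k rule: int_cases2)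
    case (nonneg n)
    then show ?thesis
      using nat by simp
  next
    case (nonpos n)
    then show ?thesis
      using nat [of "x + real_of_int k *\<^sub>R axis i 1" n i] by simp
  qed
  have "u (x + (\<Sum>i\<in>S. m $ i *\<^sub>R axis i 1)) = u x" for S
  proof (induction S arbitrary: x rule: infinite_finite_induct)
    case (insert j S)
    obtain k where "m $ j = real_of_int k"
      using m [of j] by (elim Ints_cases)
    with insert int [of "x + (\<Sum>i\<in>S. m $ i *\<^sub>R axis i 1)" k j] show ?case
      by (simp add: add_ac)
  qed simp_all
  moreover have "(\<Sum>i\<in>UNIV. m $ i *\<^sub>R axis i 1) = m"
    using basis_expansion [of m] by (simp add: scalar_mult_eq_scaleR)
  ultimately show ?thesis
    by metis
qed

text \<open>Subtracting the integer parts of the coordinates moves every point into the compact unit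
  cube.\<close>

lemma bounded_range_periodic:
  fixes u :: "real^'n::finite \<Rightarrow> 'b::metric_space"
  assumes cont: "continuous_on UNIV u" and per: "\<And>x i. u (x + axis i 1) = u x"
  shows "bounded (range u)"
proof -
  have "range u \<subseteq> u ` cbox 0 (\<chi> i. 1)"
  proof
    fix y
    assume "y \<in> range u"
    then obtain x where x: "y = u x"
      by auto
    have "x + (\<chi> i. - real_of_int \<lfloor>x $ i\<rfloor>) \<in> cbox 0 (\<chi> i. 1)"
      by (auto simp: mem_box_cart) linarith+
    moreover have "u (x + (\<chi> i. - real_of_int \<lfloor>x $ i\<rfloor>)) = u x"
      by (rule periodic_integer_shift [OF per]) simp
    ultimately show "y \<in> u ` cbox 0 (\<chi> i. 1)"
      unfolding x by (metis imageI)
  qed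
  moreover have "compact (u ` cbox 0 (\<chi> i. 1))"
    by (intro compact_continuous_image continuous_on_subset [OF cont]) auto
  ultimately show ?thesis
    by (meson bounded_subset compact_imp_bounded)
qed

lemma tendsto_tensor_poly:
  fixes \<xi> :: "'b \<Rightarrow> 'n::finite \<Rightarrow> 'a::real_normed_field"
  assumes "\<And>is. ((\<lambda>z. A z is) \<longlongrightarrow> A0 is) F" and "\<And>i. ((\<lambda>z. \<xi> z i) \<longlongrightarrow> \<xi>0 i) F"
  shows "((\<lambda>z. tensor_poly m (A z) (\<xi> z)) \<longlongrightarrow> tensor_poly m A0 \<xi>0) F"
  using assms(1)
  by (induction m arbitrary: A A0)
    (auto simp: tensor_poly_0 tensor_poly_Suc intro!: tendsto_intros assms(2))

lemma has_derivative_partial_deriv: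
  fixes u :: "real^'n::finite \<Rightarrow> real"
  assumes "u differentiable (at x)"
  shows "(u has_derivative (\<lambda>v. \<Sum>j\<in>UNIV. v $ j * partial_deriv j u x)) (at x)"
proof -
  have D: "(u has_derivative frechet_derivative u (at x)) (at x)"
    using assms by (simp add: frechet_derivative_works)
  have "frechet_derivative u (at x) v = (\<Sum>j\<in>UNIV. v $ j * partial_deriv j u x)" for v
  proof -
    have lin: "linear (frechet_derivative u (at x))"
      by (rule has_derivative_linear [OF D])
    have "frechet_derivative u (at x) (\<Sum>j\<in>UNIV. v $ j *\<^sub>R axis j 1) =
        (\<Sum>j\<in>UNIV. v $ j * partial_deriv j u x)"
      by (simp add: linear_sum [OF lin] linear_cmul [OF lin] partial_deriv_def)
    moreover have "(\<Sum>j\<in>UNIV. v $ j *\<^sub>R axis j 1) = v"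
      using basis_expansion [of v] by (simp add: scalar_mult_eq_scaleR)
    ultimately show ?thesis
      by simp
  qed
  then have "frechet_derivative u (at x) = (\<lambda>v. \<Sum>j\<in>UNIV. v $ j * partial_deriv j u x)"
    by (rule ext)
  with D show ?thesis
    by simp
qed

subsection \<open>First integrals on negative energy levels\<close>

text \<open>Only the component conjugate to \<open>x $ l\<close> may become complex; the conserved
  components stay real. The entry \<open>\<eta> $ l\<close> is overwritten by
  \<open>\<zeta>\<close>.\<close>

definition momentum :: "'n \<Rightarrow> real^'n \<Rightarrow> 'a \<Rightarrow> 'n \<Rightarrow> 'a::real_normed_field" where
  "momentum l \<eta> \<zeta> i = (if i = l then \<zeta> else of_real (\<eta> $ i))"

definition transverse_sq :: "'n::finite \<Rightarrow> real^'n \<Rightarrow> real" where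
  "transverse_sq l \<eta> = (\<Sum>i\<in>UNIV - {l}. (\<eta> $ i)\<^sup>2)"

lemma transverse_sq_nonneg: "0 \<le> transverse_sq l \<eta>"
  by (simp add: transverse_sq_def sum_nonneg)

lemma sum_momentum_sq: "(\<Sum>i\<in>UNIV. momentum l \<eta> \<zeta> i ^ 2) = \<zeta>\<^sup>2 + of_real (transverse_sq l \<eta>)"
  by (subst sum.remove [of _ l]) (auto simp: momentum_def transverse_sq_def intro!: sum.cong)

locale conformal_killing =
  fixes f :: "real^'n::finite \<Rightarrow> real" and l :: 'n and p :: nat and K :: "'n tensor_field"
  assumes smooth_f: "smooth_on_torus f"
    and depends_only_on_last: "x $ l = y $ l \<Longrightarrow> f x = f y"
    and killing: "killing_tensor (conformal_metric f) p K"
begin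

lemma f_differentiable: "f differentiable (at x)"
  using smooth_f [unfolded smooth_on_torus_def smooth_def] by (metis foldr_Nil id_apply)

lemma f_cont: "isCont f x"
  by (rule differentiable_imp_continuous_within [OF f_differentiable])

lemma f_periodic: "f (x + axis i 1) = f x"
  using smooth_f by (simp add: smooth_on_torus_def periodic_def)

lemma K_sym: "sym_tensor p (K x)"
  using killing by (simp add: killing_tensor_def sym_tensor_field_def)

lemma K_smooth: "smooth_on_torus (\<lambda>x. K x is)"
  using killing by (simp add: killing_tensor_def sym_tensor_field_def)

lemma K_differentiable: "(\<lambda>x. K x is) differentiable (at x)"
  using K_smooth [of "is", unfolded smooth_on_torus_def smooth_def] by (metis foldr_Nil id_apply)

lemma K_cont: "isCont (\<lambda>x. K x is) x"
  by (rule differentiable_imp_continuous_within [OF K_differentiable])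

lemma K_periodic: "K (x + axis i 1) = K x"
  using K_smooth by (auto simp: smooth_on_torus_def periodic_def)

lemma partial_deriv_f_zero:
  assumes "i \<noteq> l"
  shows "partial_deriv i f x = 0"
proof -
  have "(f has_derivative frechet_derivative f (at x)) (at (x + 0 *\<^sub>R axis i 1))"
    using f_differentiable by (simp add: frechet_derivative_works)
  then have "((\<lambda>t. f (x + t *\<^sub>R axis i 1)) has_derivative
      (\<lambda>t. frechet_derivative f (at x) (t *\<^sub>R axis i 1))) (at 0)"
    by (rule has_derivative_compose [rotated]) (auto intro!: derivative_eq_intros)
  moreover have "f (x + t *\<^sub>R axis i 1) = f x" for t
    by (rule depends_only_on_last) (use assms in \<open>simp add: axis_def\<close>)
  then have "((\<lambda>t. f (x + t *\<^sub>R axis i 1)) has_derivative (\<lambda>t. 0)) (at 0)"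
    by simp
  ultimately have "(\<lambda>t. frechet_derivative f (at x) (t *\<^sub>R axis i 1)) = (\<lambda>t. 0)"
    by (rule has_derivative_unique)
  from fun_cong [OF this, of 1] show ?thesis
    by (simp add: partial_deriv_def)
qed

text \<open>On the energy level \<open>- e < 0\<close> the momentum conjugate to \<open>x $ l\<close> is \<open>\<plusminus> \<i> * sqrt (minus_sq \<eta> e x)\<close>.\<close>

definition minus_sq :: "real^'n \<Rightarrow> real \<Rightarrow> real^'n \<Rightarrow> real" where
  "minus_sq \<eta> e x = transverse_sq l \<eta> + e * exp (2 * f x)"

definition level_value :: "real^'n \<Rightarrow> real \<Rightarrow> real^'n \<Rightarrow> complex" where
  "level_value \<eta> e x = tensor_poly p (K x) (momentum l \<eta> (\<i> * of_real (sqrt (minus_sq \<eta> e x))))"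

lemma minus_sq_pos: "0 < e \<Longrightarrow> 0 < minus_sq \<eta> e x"
  unfolding minus_sq_def by (intro add_nonneg_pos transverse_sq_nonneg) simp

lemma minus_sq_cong: "x $ l = y $ l \<Longrightarrow> minus_sq \<eta> e x = minus_sq \<eta> e y"
  unfolding minus_sq_def using depends_only_on_last [of x y] by simp

lemma isCont_minus_sq: "isCont (minus_sq \<eta> e) x"
  unfolding minus_sq_def by (intro continuous_intros f_cont)

lemma bounded_level_value: "bounded (range (level_value \<eta> e))"
proof (rule bounded_range_periodic)
  have "isCont (level_value \<eta> e) x" for x
    unfolding level_value_def continuous_at
    by (intro tendsto_tensor_poly isContD [OF K_cont])
      (auto simp: momentum_def intro!: tendsto_intros isContD [OF isCont_minus_sq])
  then show "continuous_on UNIV (level_value \<eta> e)"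
    by (simp add: continuous_at_imp_continuous_on)
  show "level_value \<eta> e (x + axis i 1) = level_value \<eta> e x" for x i
    by (simp add: level_value_def minus_sq_def f_periodic K_periodic)
qed

text \<open>The equations of motion at negative energy become the Cauchy-Riemann equations once the
  coordinate \<open>x $ l\<close> is parametrised by the flow \<open>\<theta>\<close> of \<open>sqrt (minus_sq \<eta> e)\<close>.\<close>

lemma level_value_plane:
  assumes e: "0 < e" and \<eta>: "\<eta> $ l = 0"
  shows "level_value \<eta> e (x + s *\<^sub>R \<eta> + u *\<^sub>R axis l 1) = level_value \<eta> e x"
proof -
  \<comment> \<open>\<open>minus_sq \<eta> e\<close> depends on \<open>x $ l\<close> alone, so its
    square root is the speed of a flow on the real line.\<close>
  define v where "v t = sqrt (minus_sq \<eta> e (axis l t))" for t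
  have v_coord: "v (y $ l) = sqrt (minus_sq \<eta> e y)" for y
    unfolding v_def by (rule arg_cong [where f = sqrt], rule minus_sq_cong) (simp add: axis_def)
  have "isCont (minus_sq \<eta> e) (t *\<^sub>R axis l 1)" for t
    by (rule isCont_minus_sq)
  then have "isCont (\<lambda>t. minus_sq \<eta> e (t *\<^sub>R axis l 1)) t" for t
    by (rule isCont_o2 [where g = "minus_sq \<eta> e", rotated]) (intro continuous_intros)
  moreover have "t *\<^sub>R axis l 1 = axis l t" for t :: real
    by (simp add: vec_eq_iff axis_def)
  ultimately have v_cont: "isCont v t" for t
    unfolding v_def by (intro continuous_intros) simp
  have v_pos: "0 < v t" for t
    unfolding v_def using minus_sq_pos [OF e] by simp
  have "bounded (range (\<lambda>y. sqrt (minus_sq \<eta> e y)))"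
    by (intro bounded_range_periodic continuous_at_imp_continuous_on ballI continuous_intros
        isCont_minus_sq)
      (simp add: minus_sq_def f_periodic)
  then obtain M where "\<And>y. \<bar>sqrt (minus_sq \<eta> e y)\<bar> \<le> M"
    by (auto simp: bounded_iff)
  then have v_bound: "v t \<le> M" for t
    unfolding v_def using abs_le_D1 by blast
  obtain \<theta> where \<theta>: "\<And>\<tau>. (\<theta> has_real_derivative v (\<theta> \<tau>)) (at \<tau>)" and surj: "surj \<theta>"
    by (rule exists_global_flow [OF v_cont v_pos v_bound]) (rule that)
  \<comment> \<open>\<open>Re z\<close> measures the displacement along \<open>\<eta>\<close> and
    \<open>Im z\<close> is the time of the flow \<open>\<theta>\<close> in the coordinate
    \<open>l\<close>; as \<open>\<eta> $ l = 0\<close>, the two do not interfere.\<close>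
  define y where "y z = x + Re z *\<^sub>R \<eta> + (\<theta> (Im z) - x $ l) *\<^sub>R axis l 1" for z
  have yl: "y z $ l = \<theta> (Im z)" for z
    by (simp add: y_def \<eta>)
  define F where "F z = level_value \<eta> e (y z)" for z
  have "\<exists>c. (F has_field_derivative c) (at z)" for z
  proof -
    define V where "V = sqrt (minus_sq \<eta> e (y z))"
    have V: "v (\<theta> (Im z)) = V" "0 < V" "V\<^sup>2 = minus_sq \<eta> e (y z)"
      using v_coord [of "y z"] v_pos [of "y z $ l"] minus_sq_pos [OF e,
          of \<eta> "y z"] by (simp_all add: V_def yl)
    define dy where "dy w = Re w *\<^sub>R \<eta> + (Im w * V) *\<^sub>R axis l 1" for w
    have "((\<lambda>z. \<theta> (Im z)) has_derivative (\<lambda>w. Im w * V)) (at z)"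
      using has_derivative_compose [of Im Im z UNIV \<theta> "\<lambda>w. w * V"] \<theta> [of "Im z"] V(1)
      by (simp add: has_field_derivative_def mult_commute_abs bounded_linear_imp_has_derivative
          bounded_linear_Im)
    then have y': "(y has_derivative dy) (at z)"
      unfolding y_def dy_def
      by (auto intro!: derivative_eq_intros bounded_linear_imp_has_derivative [OF bounded_linear_Re])
    have comp: "((\<lambda>z. u (y z)) has_derivative
        (\<lambda>w. Re w * (\<Sum>j\<in>UNIV. \<eta> $ j * partial_deriv j u (y z)) +
            Im w * V * partial_deriv l u (y z))) (at z)"
      if "u differentiable (at (y z))" for u
    proof -
      have "(\<Sum>j\<in>UNIV. dy w $ j * partial_deriv j u (y z)) =
        Re w * (\<Sum>j\<in>UNIV. \<eta> $ j * partial_deriv j u (y z)) + Im w * V * partial_deriv l u (y z)" for w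
      proof -
        have "(\<Sum>j\<in>UNIV. dy w $ j * partial_deriv j u (y z)) =
            (\<Sum>j\<in>UNIV. Re w * (\<eta> $ j * partial_deriv j u (y z)) +
              Im w * V * (if j = l then 1 else 0) * partial_deriv j u (y z))"
          by (intro sum.cong) (auto simp: dy_def axis_def algebra_simps)
        then show ?thesis
          by (simp only: sum.distrib sum_delta_scaled sum_distrib_left)
      qed
      with has_derivative_compose [OF y' has_derivative_partial_deriv [OF that]] show ?thesis
        by simp
    qed
    \<comment> \<open>The rate of change of \<open>sqrt (minus_sq \<eta> e (y z))\<close> in
      \<open>Im z\<close>. The speed \<open>V\<close> cancels against the \<open>V\<close> in the
      denominator of the derivative of the square root.\<close>
    define a where "a = e * exp (2 * f (y z)) * partial_deriv l f (y z)"
    have "(\<Sum>j\<in>UNIV. \<eta> $ j * partial_deriv j f (y z)) = 0"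
      by (rule sum.neutral) (metis \<eta> mult_eq_0_iff partial_deriv_f_zero)
    then have "((\<lambda>z. f (y z)) has_derivative (\<lambda>w. Im w * V * partial_deriv l f (y z))) (at z)"
      using comp [OF f_differentiable] by simp
    then have "((\<lambda>z. sqrt (minus_sq \<eta> e (y z))) has_derivative (\<lambda>w. Im w * a)) (at z)"
      unfolding minus_sq_def
      using V(2) minus_sq_pos [OF e, of \<eta> "y z"]
      by (auto intro!: derivative_eq_intros simp: a_def V_def minus_sq_def field_simps)
    then have "((\<lambda>z. \<i> * complex_of_real (sqrt (minus_sq \<eta> e (y z)))) has_derivative
        (\<lambda>w. \<i> * of_real (Im w * a))) (at z)"
      by (intro has_derivative_mult_right has_derivative_of_real)
    then have mom: "((\<lambda>z. momentum l \<eta> (\<i> * of_real (sqrt (minus_sq \<eta> e (y z)))) i) has_derivative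
        (\<lambda>w. if i = l then \<i> * of_real (Im w * a) else 0)) (at z)" for i
      by (cases "i = l") (simp_all add: momentum_def)
    define \<xi> :: "'n \<Rightarrow> complex" where "\<xi> = momentum l \<eta> (\<i> * of_real V)"
    define T where "T j = tensor_poly p (\<lambda>is. partial_deriv j (\<lambda>y. K y is) (y z)) \<xi>" for j
    define D where "D = of_nat p * tensor_poly (p - 1) (\<lambda>is. K (y z) (l # is)) \<xi>"
    define S where "S = (\<Sum>j\<in>UNIV. of_real (\<eta> $ j) * T j)"
    have "(F has_derivative (\<lambda>w. tensor_poly p (\<lambda>is. Re w * (\<Sum>j\<in>UNIV. \<eta> $ j * partial_deriv j (\<lambda>y. K
        y is) (y z)) +
          Im w * V * partial_deriv l (\<lambda>y. K y is) (y z)) \<xi> +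
        of_nat p * (\<Sum>i\<in>UNIV. (if i = l then \<i> * of_real (Im w * a) else 0) *
          tensor_poly (p - 1) (\<lambda>is. K (y z) (i # is)) \<xi>))) (at z)"
      unfolding F_def level_value_def \<xi>_def V_def
      by (rule has_derivative_tensor_poly [OF sym_tensor_imp_perm_invariant [OF K_sym]])
        (use comp [OF K_differentiable] mom in \<open>simp_all add: V_def\<close>)
    moreover have "tensor_poly p (\<lambda>is. Re w * (\<Sum>j\<in>UNIV. \<eta> $ j * partial_deriv j (\<lambda>y. K y is) (y z)) +
          Im w * V * partial_deriv l (\<lambda>y. K y is) (y z)) \<xi> =
        of_real (Re w) * S + of_real (Im w * V) * T l" for w
      unfolding tensor_poly_add tensor_poly_scale tensor_poly_sum S_def T_def ..
    moreover have "of_nat p * (\<Sum>i\<in>UNIV. (if i = l then \<i> * of_real (Im w * a) else 0) *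
          tensor_poly (p - 1) (\<lambda>is. K (y z) (i # is)) \<xi>) = \<i> * of_real (Im w * a) * D" for w
      by (simp add: D_def if_distrib [of "\<lambda>x. x * _"] cong: if_cong)
    \<comment> \<open>Complex linearity of the derivative amounts to
      \<open>V * T l + \<i> * a * D = \<i> * S\<close>. This is \<open>\<i>\<close> times the
      conservation law, since on this level the squares of the momenta sum to
      \<open>- e * exp (2 * f (y z))\<close>.\<close>
    moreover have "of_real (Re w) * S + of_real (Im w * V) * T l + \<i> * of_real (Im w * a) * D =
        S * w" for w
    proof -
      have "(\<Sum>j\<in>UNIV. \<xi> j * T j) = \<i> * of_real V * T l + S"
      proof -
        have "(\<Sum>j\<in>UNIV. \<xi> j * T j) = (\<Sum>j\<in>UNIV. (\<i> * of_real V) * (if j = l then 1 else 0) * T j +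
            of_real (\<eta> $ j) * T j)"
          by (rule sum.cong) (auto simp: \<xi>_def momentum_def \<eta>)
        then show ?thesis
          by (simp only: sum.distrib sum_delta_scaled S_def)
      qed
      moreover have "(\<Sum>j\<in>UNIV. \<xi> j ^ 2) * of_real (partial_deriv l f (y z)) = - of_real a"
        unfolding \<xi>_def sum_momentum_sq using V(3)
        by (simp add: power_mult_distrib a_def minus_sq_def flip: of_real_power of_real_mult)
      moreover have "(\<Sum>j\<in>UNIV. \<xi> j * T j) + (\<Sum>j\<in>UNIV. \<xi> j ^ 2) * of_real (partial_deriv l f (y z)) *
          D = 0"
        unfolding T_def D_def
        by (rule killing_tensor_conformal_imp [OF f_differentiable partial_deriv_f_zero killing])
      ultimately have "S = of_real a * D - \<i> * of_real V * T l"
        by (simp add: algebra_simps)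
      moreover have "S * w = of_real (Re w) * S + of_real (Im w) * (\<i> * S)"
        by (subst (1) complex_eq [of w]) (simp add: algebra_simps)
      ultimately have "S * w = of_real (Re w) * S + of_real (Im w) * (\<i> * (of_real a * D -
          \<i> * of_real V * T l))"
        by metis
      then show ?thesis
        by (simp add: algebra_simps)
    qed
    ultimately have "(F has_derivative (\<lambda>w. S * w)) (at z)"
      by simp
    then show ?thesis
      by (auto simp: has_field_derivative_def)
  qed
  then have "F holomorphic_on UNIV"
    by (auto simp: holomorphic_on_def field_differentiable_def)
  moreover have "bounded (range F)"
    by (rule bounded_subset [OF bounded_level_value [of \<eta> e]]) (auto simp: F_def)
  ultimately have "F constant_on UNIV"
    by (rule Liouville_theorem)
  then have const: "F z = F z'" for z z'
    by (auto simp: constant_on_def)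
  \<comment> \<open>As \<open>\<theta>\<close> is onto, \<open>y\<close> covers the whole plane:
    \<open>\<tau>\<close> reaches the target height, while \<open>\<tau>'\<close> with real part
    \<open>0\<close> gives back \<open>x\<close>.\<close>
  obtain \<tau> \<tau>' where "\<theta> \<tau> = x $ l + u" "\<theta> \<tau>' = x $ l"
    using surj by (metis surjD)
  with const [of "Complex s \<tau>" "Complex 0 \<tau>'"] show ?thesis
    by (simp add: F_def y_def)
qed

end

subsection \<open>Even and odd parts in the last momentum\<close>

lemma tendsto_transverse_sq:
  "(\<And>i. ((\<lambda>n. \<eta> n $ i) \<longlongrightarrow> \<eta>0 $ i) F) \<Longrightarrow>
    ((\<lambda>n. transverse_sq l (\<eta> n)) \<longlongrightarrow> transverse_sq l \<eta>0) F"
  unfolding transverse_sq_def by (intro tendsto_sum tendsto_power)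

text \<open>\<open>u\<close> stands for the square of the momentum \<open>l\<close>, and setting
  that momentum to \<open>1\<close> keeps only the transverse factors of a monomial. In the odd part
  the rounding of \<open>div\<close> drops one factor of the momentum.\<close>

definition parity_part :: "nat \<Rightarrow> 'n::finite \<Rightarrow> bool \<Rightarrow> 'n tensor \<Rightarrow> real^'n \<Rightarrow> real \<Rightarrow> real" where
  "parity_part m l b A \<eta> u = tensor_poly m
     (\<lambda>is. if even (count_list is l) = b then A is * u ^ (count_list is l div 2) else 0) (momentum l
         \<eta> 1)"

lemma prod_list_momentum:
  "prod_list (map (momentum l \<eta> \<zeta>) is) = of_real (prod_list (map (momentum l \<eta> 1) is)) * \<zeta> ^
      count_list is l"
  by (induction "is") (auto simp: momentum_def)

text \<open>The sign of \<open>u\<close> is free: imaginary \<open>\<zeta>\<close> serves for the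
  complex level sets, real \<open>\<zeta>\<close> for the return to actual momenta.\<close>

lemma tensor_poly_parity:
  fixes \<zeta> :: "'a::real_normed_field"
  assumes "\<zeta>\<^sup>2 = of_real u"
  shows "tensor_poly m A (momentum l \<eta> \<zeta>) =
    of_real (parity_part m l True A \<eta> u) + \<zeta> * of_real (parity_part m l False A \<eta> u)"
proof -
  have pow: "\<zeta> ^ n = of_real (u ^ (n div 2)) * (if even n then 1 else \<zeta>)" for n
    using assms by (cases "even n") (auto elim!: evenE oddE simp: power_mult)
  have "tensor_poly m A (momentum l \<eta> \<zeta>) = (\<Sum>is | length is = m.
      of_real ((if even (count_list is l) = True then A is * u ^ (count_list is l div 2) else 0) *
        prod_list (map (momentum l \<eta> 1) is)) +
      \<zeta> * of_real ((if even (count_list is l) = False then A is * u ^ (count_list is l div 2) else 0) *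
        prod_list (map (momentum l \<eta> 1) is)))"
    unfolding tensor_poly_def by (intro sum.cong refl) (simp add: prod_list_momentum [of l \<eta> \<zeta>] pow)
  then show ?thesis
    by (simp add: parity_part_def tensor_poly_def sum.distrib flip: sum_distrib_left)
qed

lemma parity_part_poly: "\<exists>q. \<forall>u. parity_part m l b A \<eta> u = poly q u"
proof (intro exI allI)
  show "parity_part m l b A \<eta> u = poly (\<Sum>is | length is = m.
      if even (count_list is l) = b
      then monom (A is * prod_list (map (momentum l \<eta> 1) is)) (count_list is l div 2) else 0) u" for u
    unfolding parity_part_def tensor_poly_def poly_sum
    by (intro sum.cong) (auto simp: poly_monom)
qed

lemma parity_part_poly_family: "\<exists>q. \<forall>z u. parity_part m l b (A z) \<eta> u = poly (q z) u"
  by (rule choice) (intro allI parity_part_poly)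

lemma tendsto_parity_part:
  assumes "\<And>i. ((\<lambda>n. \<eta> n $ i) \<longlongrightarrow> \<eta>0 $ i) F"
  shows "((\<lambda>n. parity_part m l b A (\<eta> n) u) \<longlongrightarrow> parity_part m l b A \<eta>0 u) F"
  unfolding parity_part_def
  by (intro tendsto_tensor_poly tendsto_const) (simp add: momentum_def assms)

lemma poly_eqI_infinite:
  fixes p q :: "'a::{idom, ring_char_0} poly"
  assumes "infinite S" and "\<And>x. x \<in> S \<Longrightarrow> poly p x = poly q x"
  shows "p = q"
proof (rule ccontr)
  assume "p \<noteq> q"
  then have "finite {x. poly (p - q) x = 0}"
    by (intro poly_roots_finite) simp
  moreover have "S \<subseteq> {x. poly (p - q) x = 0}"
    using assms(2) by auto
  ultimately show False
    using assms(1) finite_subset by blast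
qed

section \<open>Constancy over the torus and vanishing of the odd part\<close>

context conformal_killing
begin

lemma level_value_const:
  assumes e: "0 < e" and \<eta>: "\<eta> $ l = 0"
  shows "level_value \<eta> e x = level_value \<eta> e y"
proof -
  define m where "m N = (\<chi> i. if i = l then 0 else real_of_int \<lfloor>real N * \<eta> $ i\<rfloor>)" for N
  define d where "d = (\<chi> i. if i = l then 0 else y $ i - x $ i)"
  \<comment> \<open>After time \<open>Suc N\<close> the direction \<open>\<eta>' N\<close> leads
    from \<open>x\<close> to the lattice translate \<open>y + m (Suc N)\<close>, up to the
    coordinate \<open>l\<close>, which can be adjusted freely. The integer parts in \<open>m\<close>
    make \<open>\<eta>' N\<close> converge to \<open>\<eta>\<close>.\<close>
  define \<eta>' where "\<eta>' N = (1 / real (Suc N)) *\<^sub>R (d + m (Suc N))" for N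
  have "level_value (\<eta>' N) e x = level_value (\<eta>' N) e y" for N
  proof -
    have "level_value (\<eta>' N) e x =
        level_value (\<eta>' N) e (x + real (Suc N) *\<^sub>R \<eta>' N + (y $ l - x $ l) *\<^sub>R axis l 1)"
      by (rule level_value_plane [OF e, symmetric]) (simp add: \<eta>'_def d_def m_def)
    also have "x + real (Suc N) *\<^sub>R \<eta>' N + (y $ l - x $ l) *\<^sub>R axis l 1 = y + m (Suc N)"
      by (auto simp: \<eta>'_def d_def m_def vec_eq_iff axis_def)
    also have "level_value (\<eta>' N) e (y + m (Suc N)) = level_value (\<eta>' N) e y"
      by (rule periodic_integer_shift) (simp_all add: level_value_def minus_sq_def f_periodic
          K_periodic m_def)
    finally show ?thesis .
  qed
  moreover have lim: "(\<lambda>N. \<eta>' N $ i) \<longlonglongrightarrow> \<eta> $ i" for i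
  proof (cases "i = l")
    case True
    then show ?thesis
      by (simp add: \<eta>'_def d_def m_def \<eta>)
  next
    case False
    have "norm (\<eta>' N $ i - \<eta> $ i) \<le> (\<bar>d $ i\<bar> + 1) / real (Suc N)" for N
    proof -
      have "\<eta>' N $ i - \<eta> $ i = (d $ i + (real_of_int \<lfloor>real (Suc N) * \<eta> $ i\<rfloor> -
          real (Suc N) * \<eta> $ i)) / real (Suc N)"
        using False by (simp add: \<eta>'_def m_def add_divide_distrib diff_divide_distrib del: of_nat_Suc)
      moreover have "\<bar>d $ i + (real_of_int \<lfloor>real (Suc N) * \<eta> $ i\<rfloor> -
          real (Suc N) * \<eta> $ i)\<bar> \<le> \<bar>d $ i\<bar> + 1"
        by linarith
      ultimately show ?thesis
        by (simp add: abs_divide divide_right_mono del: of_nat_Suc)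
    qed
    moreover have "(\<lambda>N. (\<bar>d $ i\<bar> + 1) / real (Suc N)) \<longlonglongrightarrow> 0"
      using LIMSEQ_Suc [OF lim_const_over_n] by blast
    ultimately have "(\<lambda>N. \<eta>' N $ i - \<eta> $ i) \<longlonglongrightarrow> 0"
      by (rule Lim_null_comparison [OF always_eventually, rule_format])
    then show ?thesis
      by (simp add: LIM_zero_iff)
  qed
  have "(\<lambda>N. level_value (\<eta>' N) e z) \<longlonglongrightarrow> level_value \<eta> e z" for z
    unfolding level_value_def
    by (intro tendsto_tensor_poly tendsto_const)
      (auto simp: momentum_def minus_sq_def intro!: tendsto_intros lim tendsto_transverse_sq)
  ultimately show ?thesis
    using LIMSEQ_unique by (metis (no_types, lifting) ext)
qed

text \<open>At an imaginary momentum the even and odd parts become the real and imaginary parts of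
  \<open>level_value\<close>. Squaring the latter removes the square root, so that both invariants
  are polynomials in \<open>e\<close>.\<close>

lemma parity_part_level:
  assumes e: "0 < e" and \<eta>: "\<eta> $ l = 0"
  shows "parity_part p l True (K x) \<eta> (- minus_sq \<eta> e x) =
      parity_part p l True (K y) \<eta> (- minus_sq \<eta> e y)"
    and "minus_sq \<eta> e x * (parity_part p l False (K x) \<eta> (- minus_sq \<eta> e x))\<^sup>2 =
      minus_sq \<eta> e y * (parity_part p l False (K y) \<eta> (- minus_sq \<eta> e y))\<^sup>2"
proof -
  have split: "level_value \<eta> e z = Complex (parity_part p l True (K z) \<eta> (- minus_sq \<eta> e z))
      (sqrt (minus_sq \<eta> e z) * parity_part p l False (K z) \<eta> (- minus_sq \<eta> e z))" for z
  proof -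
    have "(\<i> * of_real (sqrt (minus_sq \<eta> e z)))\<^sup>2 = complex_of_real (- minus_sq \<eta> e z)"
      using minus_sq_pos [OF e, of \<eta> z] by (simp add: power_mult_distrib flip: of_real_power)
    from tensor_poly_parity [OF this] show ?thesis
      by (simp add: level_value_def complex_eq_iff)
  qed
  have eq: "level_value \<eta> e x = level_value \<eta> e y"
    by (rule level_value_const [OF e \<eta>])
  then show "parity_part p l True (K x) \<eta> (- minus_sq \<eta> e x) =
      parity_part p l True (K y) \<eta> (- minus_sq \<eta> e y)"
    by (simp add: split)
  have "(sqrt (minus_sq \<eta> e x) * parity_part p l False (K x) \<eta> (- minus_sq \<eta> e x))\<^sup>2 =
      (sqrt (minus_sq \<eta> e y) * parity_part p l False (K y) \<eta> (- minus_sq \<eta> e y))\<^sup>2"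
    using eq by (simp add: split)
  then show "minus_sq \<eta> e x * (parity_part p l False (K x) \<eta> (- minus_sq \<eta> e x))\<^sup>2 =
      minus_sq \<eta> e y * (parity_part p l False (K y) \<eta> (- minus_sq \<eta> e y))\<^sup>2"
    using minus_sq_pos [OF e, of \<eta> x] minus_sq_pos [OF e, of \<eta> y] by (simp add: power_mult_distrib)
qed

lemma minus_sq_poly: "minus_sq \<eta> e x = poly [:transverse_sq l \<eta>, exp (2 * f x):] e"
  by (simp add: minus_sq_def mult.commute)

text \<open>Both sides are polynomials in \<open>e\<close> that agree for all \<open>e > 0\<close>,
  hence for every real \<open>e\<close>. Real momenta correspond to
  \<open>e \<le> 0\<close>.\<close>

lemma parity_part_level_even:
  assumes \<eta>: "\<eta> $ l = 0"
  shows "parity_part p l True (K x) \<eta> (- minus_sq \<eta> e x) =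
      parity_part p l True (K y) \<eta> (- minus_sq \<eta> e y)"
proof -
  obtain q where q: "\<And>z u. parity_part p l True (K z) \<eta> u = poly (q z) u"
    using parity_part_poly_family [of p l True K \<eta>] by auto
  have "pcompose (q x) (- [:transverse_sq l \<eta>, exp (2 * f x):]) =
      pcompose (q y) (- [:transverse_sq l \<eta>, exp (2 * f y):])"
  proof (rule poly_eqI_infinite)
    show "infinite {0 :: real <..}"
      by (rule infinite_Ioi)
    show "poly (pcompose (q x) (- [:transverse_sq l \<eta>, exp (2 * f x):])) e =
        poly (pcompose (q y) (- [:transverse_sq l \<eta>, exp (2 * f y):])) e" if "e \<in> {0<..}" for e
      using parity_part_level(1) [of e \<eta> x y] that \<eta> by (simp only: poly_pcompose poly_minus
          minus_sq_poly q) simp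
  qed
  then have "poly (pcompose (q x) (- [:transverse_sq l \<eta>, exp (2 * f x):])) e =
        poly (pcompose (q y) (- [:transverse_sq l \<eta>, exp (2 * f y):])) e"
    by simp
  then show ?thesis
    by (simp only: poly_pcompose poly_minus minus_sq_poly q)
qed

text \<open>\<open>minus_sq \<eta> e x * (odd part)\<^sup>2\<close> is a polynomial in \<open>e\<close> that vanishes where \<open>minus_sq \<eta> e x = 0\<close>;
  as it does not depend on \<open>x\<close>, it has infinitely many zeros.\<close>

lemma parity_part_odd_zero_generic:
  assumes nonconst: "\<not> f constant_on UNIV" and \<eta>: "\<eta> $ l = 0" "0 < transverse_sq l \<eta>"
  shows "parity_part p l False (K x) \<eta> u = 0"
proof -
  define W where "W z = [:transverse_sq l \<eta>, exp (2 * f z):]" for z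
  obtain q where q: "\<And>z u. parity_part p l False (K z) \<eta> u = poly (q z) u"
    using parity_part_poly_family [of p l False K \<eta>] by auto
  define Q where "Q z = W z * (pcompose (q z) (- W z))\<^sup>2" for z
  have Q_poly: "poly (Q z) e = minus_sq \<eta> e z * (parity_part p l False (K z) \<eta> (- minus_sq \<eta> e
      z))\<^sup>2" for z e
    unfolding Q_def W_def q minus_sq_poly by (simp only: poly_mult poly_power poly_pcompose poly_minus)
  have Q_eq: "Q x = Q z" for z
  proof (rule poly_eqI_infinite)
    show "infinite {0 :: real <..}"
      by (rule infinite_Ioi)
    show "poly (Q x) e = poly (Q z) e" if "e \<in> {0<..}" for e
      using parity_part_level(2) [of e \<eta> x z] that \<eta> by (simp add: Q_poly)
  qed
  \<comment> \<open>A finite connected set of reals is a single point.\<close>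
  have "infinite (range f)"
  proof
    assume "finite (range f)"
    moreover have "connected (range f)"
      by (intro connected_continuous_image continuous_at_imp_continuous_on) (auto intro: f_cont)
    ultimately obtain c where "range f = {c}"
      using connected_finite_iff_sing by blast
    then show False
      using nonconst unfolding constant_on_def by blast
  qed
  \<comment> \<open>The value at \<open>c = f z\<close> is the zero of
    \<open>minus_sq \<eta> e z\<close> as a function of \<open>e\<close>; positivity of
    \<open>transverse_sq l \<eta>\<close> keeps the zeros for distinct \<open>c\<close>
    apart.\<close>
  moreover have "inj_on (\<lambda>c. - transverse_sq l \<eta> / exp (2 * c)) (range f)"
    using \<eta>(2) by (auto simp: inj_on_def field_simps)
  ultimately have "infinite ((\<lambda>c. - transverse_sq l \<eta> / exp (2 * c)) ` range f)"
    using finite_imageD by blast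
  moreover have "poly (Q x) e = poly 0 e" if e: "e \<in> (\<lambda>c. -
      transverse_sq l \<eta> / exp (2 * c)) ` range f" for e
  proof -
    obtain z where "e = - transverse_sq l \<eta> / exp (2 * f z)"
      using e by auto
    then have "minus_sq \<eta> e z = 0"
      by (simp add: minus_sq_def)
    then show ?thesis
      unfolding Q_eq [of z] Q_poly by simp
  qed
  ultimately have "Q x = 0"
    by (rule poly_eqI_infinite)
  moreover have "W x \<noteq> 0"
    by (simp add: W_def)
  ultimately have "pcompose (q x) (- W x) = 0"
    by (simp add: Q_def)
  \<comment> \<open>The evaluation point is the solution \<open>e\<close> of
    \<open>- poly (W x) e = u\<close>, so the vanishing carries over to arbitrary
    \<open>u\<close>.\<close>
  then have "poly (pcompose (q x) (- W x)) ((- u - transverse_sq l \<eta>) / exp (2 * f x)) = 0"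
    by simp
  then show ?thesis
    by (simp add: q poly_pcompose W_def)
qed

text \<open>If the transverse momentum vanishes, it is perturbed along a second coordinate
  \<open>k\<close>, which exists by \<open>dim\<close>; continuity in \<open>\<eta>\<close> then
  gives the claim.\<close>

lemma parity_part_odd_zero:
  assumes dim: "CARD('n) \<ge> 2" and nonconst: "\<not> f constant_on UNIV" and \<eta>: "\<eta> $ l = 0"
  shows "parity_part p l False (K x) \<eta> u = 0"
proof (cases "transverse_sq l \<eta> = 0")
  case False
  then show ?thesis
    using parity_part_odd_zero_generic [OF nonconst \<eta>] transverse_sq_nonneg [of l \<eta>] by simp
next
  case True
  have "\<exists>k. k \<noteq> l"
  proof (rule ccontr)
    assume "\<nexists>k. k \<noteq> l"
    then have "(UNIV :: 'n set) = {l}"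
      by auto
    then have "CARD('n) = card {l}"
      by (rule arg_cong)
    with dim show False
      by simp
  qed
  then obtain k where k: "k \<noteq> l"
    by blast
  define \<eta>' where "\<eta>' N = \<eta> + (1 / real (Suc N)) *\<^sub>R axis k 1" for N
  have "\<eta> $ k = 0"
    using True k by (auto simp: transverse_sq_def sum_nonneg_eq_0_iff)
  then have "0 < transverse_sq l (\<eta>' N)" for N
    unfolding transverse_sq_def using k by (intro sum_pos2 [of _ k]) (auto simp: \<eta>'_def axis_def)
  then have "parity_part p l False (K x) (\<eta>' N) u = 0" for N
    by (intro parity_part_odd_zero_generic [OF nonconst]) (use \<eta> k in \<open>auto simp: \<eta>'_def axis_def\<close>)
  moreover have "(\<lambda>N. parity_part p l False (K x) (\<eta>' N) u) \<longlonglongrightarrow> parity_part p l False (K x) \<eta> u"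
  proof (rule tendsto_parity_part)
    show "(\<lambda>N. \<eta>' N $ i) \<longlonglongrightarrow> \<eta> $ i" for i
      using tendsto_add [OF tendsto_const tendsto_mult [OF LIMSEQ_Suc [OF lim_const_over_n [of 1]]
          tendsto_const], of "\<eta> $ i" "axis k 1 $ i"]
      by (simp add: \<eta>'_def)
  qed
  ultimately show ?thesis
    by (simp add: LIMSEQ_const_iff)
qed

text \<open>With the odd part gone, the value depends only on the transverse momenta and the energy,
  so it can be computed at any base point \<open>y\<close>. The last argument is the square of the
  momentum \<open>l\<close> that these data prescribe at \<open>y\<close>.\<close>

lemma tensor_poly_K_eq:
  assumes dim: "CARD('n) \<ge> 2" and nonconst: "\<not> f constant_on UNIV"
  shows "tensor_poly p (K x) \<xi> = parity_part p l True (K y) (\<chi> i. if i = l then 0 else \<xi> i)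
    (exp (2 * f y) * (exp (- 2 * f x) * (\<Sum>i\<in>UNIV. (\<xi> i)\<^sup>2)) - (\<Sum>i\<in>UNIV - {l}. (\<xi> i)\<^sup>2))"
proof -
  define \<eta> where "\<eta> = (\<chi> i. if i = l then 0 else \<xi> i)"
  have \<eta>l: "\<eta> $ l = 0"
    by (simp add: \<eta>_def)
  have T: "transverse_sq l \<eta> = (\<Sum>i\<in>UNIV - {l}. (\<xi> i)\<^sup>2)"
    by (auto simp: transverse_sq_def \<eta>_def intro!: sum.cong)
  define e where "e = - (exp (- 2 * f x) * (\<Sum>i\<in>UNIV. (\<xi> i)\<^sup>2))"
  have "\<xi> = momentum l \<eta> (\<xi> l)"
    by (auto simp: momentum_def \<eta>_def)
  then have "tensor_poly p (K x) \<xi> = tensor_poly p (K x) (momentum l \<eta> (\<xi> l))"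
    by simp
  also have "\<dots> = parity_part p l True (K x) \<eta> ((\<xi> l)\<^sup>2)"
    using tensor_poly_parity [of "\<xi> l" "(\<xi> l)\<^sup>2" p "K x" l \<eta>] parity_part_odd_zero [OF dim nonconst
        \<eta>l] by simp
  also have "(\<xi> l)\<^sup>2 = - minus_sq \<eta> e x"
  proof -
    have "(\<Sum>i\<in>UNIV. (\<xi> i)\<^sup>2) = (\<xi> l)\<^sup>2 + (\<Sum>i\<in>UNIV - {l}. (\<xi> i)\<^sup>2)"
      by (rule sum.remove) auto
    then show ?thesis
      by (simp add: minus_sq_def T e_def exp_minus field_simps)
  qed
  also have "parity_part p l True (K x) \<eta> (- minus_sq \<eta> e x) =
      parity_part p l True (K y) \<eta> (- minus_sq \<eta> e y)"
    by (rule parity_part_level_even [OF \<eta>l])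
  also have "- minus_sq \<eta> e y = exp (2 * f y) * (exp (- 2 * f x) * (\<Sum>i\<in>UNIV. (\<xi> i)\<^sup>2)) - (\<Sum>i\<in>UNIV -
      {l}. (\<xi> i)\<^sup>2)"
    by (simp add: minus_sq_def T e_def)
  finally show ?thesis
    by (simp add: \<eta>_def)
qed

end

section \<open>Assembling the polynomial\<close>

lemma length_filter_add_count_list: "length (filter (\<lambda>i. i \<noteq> l) xs) + count_list xs l = length xs"
  by (induction xs) auto

text \<open>\<open>nonconstant_f\<close> excludes flat metrics, for which
  \<open>coord_field l\<close> is parallel and hence also Killing. \<open>dim\<close> excludes the
  circle, where the unit vector field is Killing but of odd degree, unlike any power of the
  metric.\<close>

theorem theorem1p1:
  fixes f :: "real^'n::finite \<Rightarrow> real" and l :: 'n and p :: nat and K :: "'n tensor_field"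
  assumes dim: "CARD('n) \<ge> 2"
    and smooth_f: "smooth_on_torus f"
    and depends_only_on_last: "\<And>x y. x $ l = y $ l \<Longrightarrow> f x = f y"
    and nonconstant_f: "\<not> f constant_on UNIV"
    and killing: "killing_tensor (conformal_metric f) p K"
  shows "K \<in> polynomials_in (coord_field ` (UNIV - {l}) \<union> {metric_tensor (conformal_metric f)})"
    (is "K \<in> polynomials_in ?G")
proof -
  interpret conformal_killing f l p K
    by unfold_locales (fact smooth_f, erule depends_only_on_last, fact killing)
  have coord: "polynomial_symbol ?G 1 (\<lambda>x \<xi>. \<xi> i)" if "i \<noteq> l" for i
    by (rule polynomial_symbol_coord_field) (use that in blast)
  \<comment> \<open>The square of the momentum \<open>l\<close> transported to the base point
    \<open>0\<close>. The factor \<open>exp (2 * f 0)\<close> is a constant, so \<open>U\<close>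
    combines the symbol of the metric and squares of coordinate symbols with constant
    coefficients.\<close>
  define U where "U x \<xi> = exp (2 * f 0) * (exp (- 2 * f x) * (\<Sum>i\<in>UNIV. (\<xi> i)\<^sup>2)) -
      (\<Sum>i\<in>UNIV - {l}. (\<xi> i)\<^sup>2)"
    for x and \<xi> :: "'n \<Rightarrow> real"
  have U: "polynomial_symbol ?G 2 U"
  proof -
    have "polynomial_symbol ?G (1 * 2) (\<lambda>x \<xi>. \<xi> i ^ 2)" if "i \<noteq> l" for i
      by (rule polynomial_symbol_power [OF coord [OF that]])
    then have sum: "polynomial_symbol ?G 2 (\<lambda>x \<xi>. \<Sum>i\<in>UNIV - {l}. \<xi> i ^ 2)"
      by (intro polynomial_symbol_sum) simp
    have metric: "polynomial_symbol ?G 2 (\<lambda>x \<xi>. exp (- 2 * f x) * (\<Sum>i\<in>UNIV. \<xi> i ^ 2) / 2)"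
      by (rule polynomial_symbol_metric_tensor) simp
    have "U = (\<lambda>x \<xi>. 2 * exp (2 * f 0) * (exp (- 2 * f x) * (\<Sum>i\<in>UNIV. \<xi> i ^ 2) / 2) +
        - 1 * (\<Sum>i\<in>UNIV - {l}. \<xi> i ^ 2))"
      by (simp add: U_def fun_eq_iff)
    then show ?thesis
      by (simp only:) (intro polynomial_symbol_add polynomial_symbol_scale sum metric)
  qed
  have mon: "polynomial_symbol ?G (length (filter (\<lambda>i. i \<noteq> l) is))
      (\<lambda>x \<xi>. prod_list (map (\<lambda>i. if i = l then 1 else \<xi> i) is))" for "is"
  proof (induction "is")
    case Nil
    show ?case
      using polynomial_symbol_const by simp
  next
    case (Cons i "is")
    show ?case
    proof (cases "i = l")
      case True
      with Cons show ?thesis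
        by simp
    next
      case False
      with polynomial_symbol_mult [OF coord [OF False] Cons] show ?thesis
        by simp
    qed
  qed
  have summand: "polynomial_symbol ?G p (\<lambda>x \<xi>. K 0 is *
      (prod_list (map (\<lambda>i. if i = l then 1 else \<xi> i) is) * U x \<xi> ^ (count_list is l div 2)))"
    if "length is = p" "even (count_list is l)" for "is"
  proof -
    have "polynomial_symbol ?G (length (filter (\<lambda>i. i \<noteq> l) is) +
        2 * (count_list is l div 2)) (\<lambda>x \<xi>. K 0 is *
        (prod_list (map (\<lambda>i. if i = l then 1 else \<xi> i) is) * U x \<xi> ^ (count_list is l div 2)))"
      by (rule polynomial_symbol_scale [OF polynomial_symbol_mult [OF mon polynomial_symbol_power
          [OF U]]])
    \<comment> \<open>Each pair of indices \<open>l\<close> is traded for one quadratic factor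
      \<open>U\<close>; since their number is even, the total degree remains
      \<open>p\<close>.\<close>
    moreover have "length (filter (\<lambda>i. i \<noteq> l) is) + 2 * (count_list is l div 2) = p"
      using that length_filter_add_count_list [of l "is"] by simp
    ultimately show ?thesis
      by simp
  qed
  have expand: "tensor_poly p (K x) \<xi> / fact p = 1 / fact p * (\<Sum>is | length is = p \<and>
      even (count_list is l).
      K 0 is * (prod_list (map (\<lambda>i. if i = l then 1 else \<xi> i) is) * U x \<xi> ^ (count_list is l div 2)))"
    for x and \<xi> :: "'n \<Rightarrow> real"
  proof -
    have mom: "momentum l (\<chi> i. if i = l then 0 else \<xi> i) 1 = (\<lambda>i. if i = l then 1 else \<xi> i)"
      by (auto simp: momentum_def)
    have "tensor_poly p (K x) \<xi> = parity_part p l True (K 0) (\<chi> i. if i = l then 0 else \<xi> i) (U x \<xi>)"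
      unfolding U_def by (rule tensor_poly_K_eq [OF dim nonconstant_f])
    also have "\<dots> = (\<Sum>is | length is = p. if even (count_list is l) then
        K 0 is * (prod_list (map (\<lambda>i. if i = l then 1 else \<xi> i) is) *
          U x \<xi> ^ (count_list is l div 2)) else 0)"
      unfolding parity_part_def tensor_poly_def mom by (intro sum.cong) auto
    also have "\<dots> = (\<Sum>is | length is = p \<and> even (count_list is l).
        K 0 is * (prod_list (map (\<lambda>i. if i = l then 1 else \<xi> i) is) * U x \<xi> ^ (count_list is l div 2)))"
      by (subst sum.inter_filter [symmetric]) simp_all
    finally show ?thesis
      by simp
  qed
  show ?thesis
  proof (rule polynomials_inI [OF _ K_sym])
    show "polynomial_symbol ?G p (\<lambda>x \<xi>. tensor_poly p (K x) \<xi> / fact p)"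
      unfolding expand by (intro polynomial_symbol_scale polynomial_symbol_sum summand) auto
  qed
qed

end
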